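(* For $n\geq 3$ with $n\neq 4,6$, every non-cyclic homomorphism $f:B_n\to S_n$ is conjugate to the standard projection $\pi:B_n\to S_n$. Also, up to conjugation, the only exceptional non-cyclic homomorphism $f:B_6\to S_6$ (i.e. the only one not conjugate to $\pi$) is the composition of $\pi:B_6\to S_6$ with the only non-trivial (up to conjugation) outer automorphism of $S_6$, defined by $(1,2)\mapsto (1,2)(3,4)(5,6)$ and $(1,2,3,4,5,6)\mapsto (1,2,3)(4,5)$.
   Context: $B_n$ is the Artin braid group on $n$ strands, with presentation $\langle \sigma_1,\dots,\sigma_{n-1}\mid \sigma_i\sigma_{i+1}\sigma_i=\sigma_{i+1}\sigma_i\sigma_{i+1}\ (1\le i<n-1),\ \sigma_i\sigma_j=\sigma_j\sigma_i\ (|i-j|>1)\rangle$. $S_n$ is the symmetric group on $n$ letters, and the standard projection $\pi:B_n\to S_n$ is given by $\sigma_i\mapsto (i,i+1)$. A homomorphism is called non-cyclic if its image is not a cyclic group. Two homomorphisms $f,f':B_n\to S_n$ are conjugate if there is $s\in S_n$ with $f'(x)=s f(x)s^{-1}$ for all $x\in B_n$. *)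

theory Defs
  imports "HOL-Algebra.Sym_Groups" "HOL-Algebra.Elementary_Groups" "HOL-Algebra.Bij"
begin

section \<open>Groups given by a presentation\<close>

text \<open>A word over a generating set \<open>I\<close> is a list of letters, where \<open>(i, True)\<close> is the
  generator \<open>i\<close> and \<open>(i, False)\<close> its inverse.\<close>

type_synonym 'a group_word = "('a \<times> bool) list"

definition group_words :: "'a set \<Rightarrow> 'a group_word set" where
  "group_words I = lists (I \<times> UNIV)"

inductive_set pres_rel :: "'a set \<Rightarrow> ('a group_word \<times> 'a group_word) set
    \<Rightarrow> ('a group_word \<times> 'a group_word) set"
  for I :: "'a set" and R :: "('a group_word \<times> 'a group_word) set" where
  pres_refl: "w \<in> group_words I \<Longrightarrow> (w, w) \<in> pres_rel I R"
| pres_sym: "(u, v) \<in> pres_rel I R \<Longrightarrow> (v, u) \<in> pres_rel I R"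
| pres_trans: "(u, v) \<in> pres_rel I R \<Longrightarrow> (v, w) \<in> pres_rel I R \<Longrightarrow> (u, w) \<in> pres_rel I R"
| pres_append: "(u, u') \<in> pres_rel I R \<Longrightarrow> (v, v') \<in> pres_rel I R
    \<Longrightarrow> (u @ v, u' @ v') \<in> pres_rel I R"
| pres_cancel: "i \<in> I \<Longrightarrow> ([(i, b), (i, \<not> b)], []) \<in> pres_rel I R"
| pres_relation: "(u, v) \<in> R \<Longrightarrow> u \<in> group_words I \<Longrightarrow> v \<in> group_words I
    \<Longrightarrow> (u, v) \<in> pres_rel I R"

definition presented_group :: "'a set \<Rightarrow> ('a group_word \<times> 'a group_word) set
    \<Rightarrow> 'a group_word set monoid" where
  "presented_group I R =
    \<lparr> carrier = group_words I // pres_rel I R,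
      monoid.mult = (\<lambda>A B. \<Union>u\<in>A. \<Union>v\<in>B. pres_rel I R `` {u @ v}),
      one = pres_rel I R `` {[]} \<rparr>"

definition word_eval :: "('b, 'c) monoid_scheme \<Rightarrow> ('a \<Rightarrow> 'b) \<Rightarrow> 'a group_word \<Rightarrow> 'b" where
  "word_eval G g w =
    foldr (\<lambda>(i, b) x. (if b then g i else inv\<^bsub>G\<^esub> (g i)) \<otimes>\<^bsub>G\<^esub> x) w \<one>\<^bsub>G\<^esub>"

text \<open>The map out of a presented group that sends each generator \<open>i\<close> to \<open>g i\<close>. It is only
  meaningful if \<open>g\<close> satisfies the relations: then evaluation is constant on each class.\<close>

definition pres_lift :: "('b, 'c) monoid_scheme \<Rightarrow> ('a \<Rightarrow> 'b) \<Rightarrow> 'a group_word set \<Rightarrow> 'b" where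
  "pres_lift G g A = the_elem (word_eval G g ` A)"

lemma pres_rel_words:
  "(u, v) \<in> pres_rel I R \<Longrightarrow> u \<in> group_words I \<and> v \<in> group_words I"
  by (induction rule: pres_rel.induct) (auto simp: group_words_def)

lemma equiv_pres_rel: "equiv (group_words I) (pres_rel I R)"
proof (rule equivI)
  show "pres_rel I R \<subseteq> group_words I \<times> group_words I"
    using pres_rel_words by fast
  show "refl_on (group_words I) (pres_rel I R)"
    by (auto intro: refl_onI pres_refl)
  show "sym (pres_rel I R)"
    by (auto intro: symI pres_sym)
  show "trans (pres_rel I R)"
    by (auto intro: transI pres_trans)
qed

lemma presented_group_mult:
  assumes "u \<in> group_words I" "v \<in> group_words I"
  shows "pres_rel I R `` {u} \<otimes>\<^bsub>presented_group I R\<^esub> pres_rel I R `` {v} = pres_rel I R `` {u @ v}"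
proof -
  let ?c = "\<lambda>w. pres_rel I R `` {w}"
  have "?c (u' @ v') = ?c (u @ v)" if "u' \<in> ?c u" "v' \<in> ?c v" for u' v'
    using equiv_class_eq[OF equiv_pres_rel pres_append, of u u' I R v v'] that by simp
  moreover have "u \<in> ?c u" "v \<in> ?c v"
    using assms by (auto intro: pres_refl)
  ultimately have "(\<Union>u'\<in>?c u. \<Union>v'\<in>?c v. ?c (u' @ v')) = ?c (u @ v)"
    by blast
  then show ?thesis
    by (simp add: presented_group_def)
qed

lemma presented_group_carrierE:
  assumes "A \<in> carrier (presented_group I R)"
  obtains w where "w \<in> group_words I" "A = pres_rel I R `` {w}"
  using assms by (auto simp: presented_group_def elim: quotientE)

lemma class_in_presented_group:
  "w \<in> group_words I \<Longrightarrow> pres_rel I R `` {w} \<in> carrier (presented_group I R)"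
  by (simp add: presented_group_def quotientI)

lemma pres_rel_inverse:
  assumes "w \<in> group_words I"
  shows "(rev (map (\<lambda>(i, b). (i, \<not> b)) w) @ w, []) \<in> pres_rel I R"
  using assms
proof (induction w)
  case Nil
  show ?case by (auto intro: pres_refl simp: group_words_def)
next
  case (Cons a w)
  obtain i b where a: "a = (i, b)" by force
  let ?w' = "rev (map (\<lambda>(i, b). (i, \<not> b)) w)"
  have i: "i \<in> I" and w: "w \<in> group_words I" "?w' \<in> group_words I"
    using Cons.prems by (auto simp: a group_words_def)
  have "([(i, \<not> b), (i, b)], []) \<in> pres_rel I R"
    using pres_cancel[OF i, of "\<not> b"] by simp
  then have "(?w' @ ([(i, \<not> b), (i, b)] @ w), ?w' @ ([] @ w)) \<in> pres_rel I R"
    using w by (blast intro: pres_append pres_refl)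
  then show ?case
    using Cons.IH[OF w(1)] by (auto simp: a intro: pres_trans)
qed

lemma presented_group_is_group: "group (presented_group I R)"
proof (rule groupI)
  let ?G = "presented_group I R"
  have nil: "[] \<in> group_words I" by (simp add: group_words_def)
  have app: "u @ v \<in> group_words I" if "u \<in> group_words I" "v \<in> group_words I" for u v
    using that by (simp add: group_words_def)
  have one: "\<one>\<^bsub>?G\<^esub> = pres_rel I R `` {[]}" by (simp add: presented_group_def)
  show "\<one>\<^bsub>?G\<^esub> \<in> carrier ?G"
    using nil by (simp add: one class_in_presented_group)
  fix A assume "A \<in> carrier ?G"
  then obtain a where a: "a \<in> group_words I" "A = pres_rel I R `` {a}"
    by (rule presented_group_carrierE)
  show "\<one>\<^bsub>?G\<^esub> \<otimes>\<^bsub>?G\<^esub> A = A"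
    using a nil by (simp add: one presented_group_mult)
  let ?a' = "rev (map (\<lambda>(i, b). (i, \<not> b)) a)"
  have "?a' \<in> group_words I" using a(1) by (auto simp: group_words_def)
  moreover have "pres_rel I R `` {?a' @ a} = pres_rel I R `` {[]}"
    using equiv_class_eq[OF equiv_pres_rel pres_rel_inverse[OF a(1)]] .
  ultimately have "pres_rel I R `` {?a'} \<otimes>\<^bsub>?G\<^esub> A = \<one>\<^bsub>?G\<^esub>"
    using a by (simp only: one presented_group_mult)
  then show "\<exists>B\<in>carrier ?G. B \<otimes>\<^bsub>?G\<^esub> A = \<one>\<^bsub>?G\<^esub>"
    using class_in_presented_group[OF \<open>?a' \<in> group_words I\<close>] by (rule bexI)
  fix B assume "B \<in> carrier ?G"
  then obtain b where b: "b \<in> group_words I" "B = pres_rel I R `` {b}"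
    by (rule presented_group_carrierE)
  show "A \<otimes>\<^bsub>?G\<^esub> B \<in> carrier ?G"
    using a b app by (simp add: presented_group_mult class_in_presented_group)
  fix C assume "C \<in> carrier ?G"
  then obtain c where c: "c \<in> group_words I" "C = pres_rel I R `` {c}"
    by (rule presented_group_carrierE)
  show "A \<otimes>\<^bsub>?G\<^esub> B \<otimes>\<^bsub>?G\<^esub> C = A \<otimes>\<^bsub>?G\<^esub> (B \<otimes>\<^bsub>?G\<^esub> C)"
    using a b c app by (simp add: presented_group_mult)
qed

context group
begin

lemma word_eval_closed:
  assumes "g \<in> I \<rightarrow> carrier G" "w \<in> group_words I"
  shows "word_eval G g w \<in> carrier G"
  using assms(2) by (induction w) (use assms(1) in
      \<open>auto simp: word_eval_def group_words_def dest: funcset_mem\<close>)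

lemma word_eval_append:
  assumes "g \<in> I \<rightarrow> carrier G" "u \<in> group_words I" "v \<in> group_words I"
  shows "word_eval G g (u @ v) = word_eval G g u \<otimes> word_eval G g v"
  using assms(2)
proof (induction u)
  case Nil
  then show ?case using word_eval_closed[OF assms(1,3)] by (simp add: word_eval_def)
next
  case (Cons a u)
  obtain i b where a: "a = (i, b)" by force
  have i: "g i \<in> carrier G" and u: "u \<in> group_words I"
    using Cons.prems assms(1) by (auto simp: a group_words_def)
  have step: "word_eval G g ((i, b) # w) = (if b then g i else inv (g i)) \<otimes> word_eval G g w" for w
    by (simp add: word_eval_def)
  show ?case
    using Cons.IH[OF u] i word_eval_closed[OF assms(1) u] word_eval_closed[OF assms(1,3)]
    by (simp add: a step m_assoc)
qed

lemma word_eval_pres_rel: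
  assumes g: "g \<in> I \<rightarrow> carrier G"
    and R: "\<And>u v. (u, v) \<in> R \<Longrightarrow> word_eval G g u = word_eval G g v"
    and uv: "(u, v) \<in> pres_rel I R"
  shows "word_eval G g u = word_eval G g v"
  using uv
proof (induction rule: pres_rel.induct)
  case (pres_append u u' v v')
  then show ?case
    using pres_rel_words by (metis word_eval_append[OF g])
next
  case (pres_cancel i b)
  then have "g i \<in> carrier G" using g by auto
  then show ?case by (simp add: word_eval_def)
qed (use R in auto)

lemma pres_lift_class:
  assumes "g \<in> I \<rightarrow> carrier G"
    and "\<And>u v. (u, v) \<in> R \<Longrightarrow> word_eval G g u = word_eval G g v"
    and "w \<in> group_words I"
  shows "pres_lift G g (pres_rel I R `` {w}) = word_eval G g w"
proof -
  have "w \<in> pres_rel I R `` {w}"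
    using pres_refl[OF assms(3)] by simp
  moreover have "word_eval G g v = word_eval G g w" if "v \<in> pres_rel I R `` {w}" for v
    using word_eval_pres_rel[OF assms(1,2), of R w v] that by simp
  ultimately have "word_eval G g ` (pres_rel I R `` {w}) = {word_eval G g w}"
    by blast
  then show ?thesis by (simp add: pres_lift_def)
qed

lemma pres_lift_hom:
  assumes "g \<in> I \<rightarrow> carrier G"
    and "\<And>u v. (u, v) \<in> R \<Longrightarrow> word_eval G g u = word_eval G g v"
  shows "pres_lift G g \<in> hom (presented_group I R) G"
proof (rule homI)
  fix A assume "A \<in> carrier (presented_group I R)"
  then obtain a where a: "a \<in> group_words I" "A = pres_rel I R `` {a}"
    by (rule presented_group_carrierE)
  show "pres_lift G g A \<in> carrier G"
    using a word_eval_closed[OF assms(1)] by (simp add: pres_lift_class[OF assms])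
  fix B assume "B \<in> carrier (presented_group I R)"
  then obtain b where b: "b \<in> group_words I" "B = pres_rel I R `` {b}"
    by (rule presented_group_carrierE)
  have "a @ b \<in> group_words I" using a b by (simp add: group_words_def)
  then show "pres_lift G g (A \<otimes>\<^bsub>presented_group I R\<^esub> B) = pres_lift G g A \<otimes> pres_lift G g B"
    using a b by (simp add: presented_group_mult pres_lift_class[OF assms] word_eval_append[OF assms(1)])
qed

end


section \<open>The braid group and its projection to the symmetric group\<close>

definition braid_relations :: "nat \<Rightarrow> (nat group_word \<times> nat group_word) set" where
  "braid_relations n =
    {([(i, True), (i + 1, True), (i, True)], [(i + 1, True), (i, True), (i + 1, True)]) | i.
        1 \<le> i \<and> i + 1 < n} \<union>
    {([(i, True), (j, True)], [(j, True), (i, True)]) | i j.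
        i \<in> {1..<n} \<and> j \<in> {1..<n} \<and> \<bar>int i - int j\<bar> > 1}"

definition braid_group :: "nat \<Rightarrow> nat group_word set monoid" where
  "braid_group n = presented_group {1..<n} (braid_relations n)"

definition braid_gen :: "nat \<Rightarrow> nat \<Rightarrow> nat group_word set" where
  "braid_gen n i = pres_rel {1..<n} (braid_relations n) `` {[(i, True)]}"

definition standard_projection :: "nat \<Rightarrow> nat group_word set \<Rightarrow> (nat \<Rightarrow> nat)" where
  "standard_projection n = pres_lift (sym_group n) (\<lambda>i. transpose i (i + 1))"

lemma braid_group_is_group: "group (braid_group n)"
  unfolding braid_group_def by (rule presented_group_is_group)

lemma transpose_generators: "(\<lambda>i. transpose i (i + 1)) \<in> {1..<n} \<rightarrow> carrier (sym_group n)"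
  by (auto simp: sym_group_carrier intro!: permutes_swap_id)

lemma transpose_braid_relations:
  assumes "(u, v) \<in> braid_relations n"
  shows "word_eval (sym_group n) (\<lambda>i. transpose i (i + 1)) u
    = word_eval (sym_group n) (\<lambda>i. transpose i (i + 1)) v"
proof -
  consider
    i where "u = [(i, True), (i + 1, True), (i, True)]"
      "v = [(i + 1, True), (i, True), (i + 1, True)]"
  | i j where "u = [(i, True), (j, True)]" "v = [(j, True), (i, True)]" "\<bar>int i - int j\<bar> > 1"
    using assms unfolding braid_relations_def by blast
  then show ?thesis
  proof cases
    case 1
    have "transpose i (i + 1) \<circ> transpose (i + 1) (i + 2) \<circ> transpose i (i + 1)
        = transpose (i + 1) (i + 2) \<circ> transpose i (i + 1) \<circ> transpose (i + 1) (i + 2)"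
      by (rule ext) (simp add: transpose_def)
    then show ?thesis
      using 1 by (simp add: word_eval_def sym_group_mult sym_group_one comp_assoc)
  next
    case 2
    have "i \<noteq> j" "i + 1 \<noteq> j" "j + 1 \<noteq> i" using 2(3) by auto
    then have "transpose i (i + 1) \<circ> transpose j (j + 1)
        = transpose j (j + 1) \<circ> transpose i (i + 1)"
      by (intro ext) (simp add: transpose_def)
    then show ?thesis
      using 2 by (simp add: word_eval_def sym_group_mult sym_group_one)
  qed
qed

lemma standard_projection_hom: "standard_projection n \<in> hom (braid_group n) (sym_group n)"
  unfolding standard_projection_def braid_group_def
  by (rule group.pres_lift_hom[OF sym_group_is_group transpose_generators transpose_braid_relations])

lemma standard_projection_gen:
  assumes "i \<in> {1..<n}"
  shows "standard_projection n (braid_gen n i) = transpose i (i + 1)"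
proof -
  have "[(i, True)] \<in> group_words {1..<n}" using assms by (simp add: group_words_def)
  then show ?thesis
    unfolding standard_projection_def braid_gen_def
    using group.pres_lift_class[OF sym_group_is_group transpose_generators transpose_braid_relations]
    by (simp add: word_eval_def sym_group_mult sym_group_one)
qed


section \<open>Conjugate and non-cyclic homomorphisms\<close>

definition noncyclic_hom :: "('a, 'c) monoid_scheme \<Rightarrow> ('b, 'd) monoid_scheme \<Rightarrow> ('a \<Rightarrow> 'b) \<Rightarrow> bool" where
  "noncyclic_hom G H f \<longleftrightarrow>
    f \<in> hom G H \<and> \<not> cyclic_group (H\<lparr>carrier := f ` carrier G\<rparr>)"

definition conjugate_homs :: "('a, 'c) monoid_scheme \<Rightarrow> ('b, 'd) monoid_scheme
    \<Rightarrow> ('a \<Rightarrow> 'b) \<Rightarrow> ('a \<Rightarrow> 'b) \<Rightarrow> bool" where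
  "conjugate_homs G H f f' \<longleftrightarrow>
    (\<exists>s\<in>carrier H. \<forall>x\<in>carrier G. f' x = s \<otimes>\<^bsub>H\<^esub> f x \<otimes>\<^bsub>H\<^esub> inv\<^bsub>H\<^esub> s)"

definition outer_automorphism :: "('a, 'c) monoid_scheme \<Rightarrow> ('a \<Rightarrow> 'a) \<Rightarrow> bool" where
  "outer_automorphism G \<phi> \<longleftrightarrow>
    \<phi> \<in> auto G \<and> \<not> (\<exists>s\<in>carrier G. \<forall>x\<in>carrier G. \<phi> x = s \<otimes>\<^bsub>G\<^esub> x \<otimes>\<^bsub>G\<^esub> inv\<^bsub>G\<^esub> s)"

end

(* Let s_1, ..., s_{n-1} be the images of the standard generators. For n >= 7 the elements
   s_3, ..., s_{n-1} centralize s_1, so the braid group on n - 2 strands acts on the set of s_1-orbits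
   of each fixed size r. If such a set has fewer than n - 2 elements, then inductively s_3, s_5 and s_6
   act on it in the same way, hence differ by powers of s_1 on each orbit, and as s_3 commutes with s_5
   and s_6, the latter commute on these orbits. They cannot commute everywhere, so some r admits at
   least n - 2 orbits; this forces r = 1, that is, s_1 fixes n - 2 points and is a transposition.
   For n = 5, 6 the same idea with s_3 and s_4 leaves only transpositions and, for n = 6,
   fixed-point-free involutions. A braid chain of transpositions is conjugate to the standard one, and
   the fixed-point-free involutions of six points are turned into transpositions by the outer
   automorphism, which is built from its values on the fifteen transpositions. *)

theory Submission
  imports Defs "HOL-Combinatorics.Orbits"
begin

section \<open>Orbits of a permutation and of its centralizer\<close>

text \<open>Two neighbouring generators commute only if all generators act alike. So some x
  witnesses that a chosen neighbouring pair does not commute, and only the orbits of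
  \<open>s 1\<close> of the same size r as that of x matter. If there are at least n - 2 of them,
  then r (n - 2) \<le> n, and r = 1 once n > 4. The value n = 4 is genuinely different:
  \<open>s 1\<close> and \<open>s 3\<close> may agree there without \<open>s 2\<close>. For n = 5, 6
  too few generators commute with \<open>s 1\<close> to provide a neighbouring pair and a third
  generator commuting with both, which is why these cases need their own count.

  The table of fifteen involutions is forced by the prescribed values: (1 2)(3 4)(5 6) belongs to (1
  2), conjugation by (1 2 3)(4 5) gives the involutions of the other adjacent transpositions, and
  conjugating these by one another gives the rest. It is Sylvester's correspondence between pairs
  and synthemes, the partitions into three pairs. Uniqueness of the outer automorphism up to
  conjugation is not an input; it follows from the classification of braid homomorphisms.\<close>

lemma self_in_orbit_bij_betw:
  assumes "bij_betw a X X" "finite X" "x \<in> X"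
  shows "x \<in> orbit a x"
proof -
  \<comment> \<open>\<open>orbit a x\<close> starts at \<open>a x\<close>, so containing x means
    that some positive power of a returns to x. This holds for finite permutations of a whole type;
    a is controlled only on X and is therefore replaced by the identity elsewhere.\<close>
  let ?a = "\<lambda>y. if y \<in> X then a y else y"
  have "bij_betw ?a X X"
    by (rule iffD2[OF bij_betw_cong assms(1)]) simp
  then have "?a permutes X"
    by (intro bij_imp_permutes) auto
  then have "x \<in> orbit ?a x"
    using permutation_self_in_orbit[of ?a x] assms(2) by (auto simp: permutation_permutes)
  moreover have "orbit a x = orbit ?a x"
    using assms by (intro orbit_cong0[of x X]) (auto dest: bij_betwE)
  ultimately show ?thesis by simp
qed

lemma orbit_subset_bij_betw:
  assumes "bij_betw a X X" "x \<in> X"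
  shows "orbit a x \<subseteq> X"
proof
  fix y assume "y \<in> orbit a x"
  then show "y \<in> X"
    by induct (use assms in \<open>auto dest: bij_betwE\<close>)
qed

lemma orbit_eq_bij_betw:
  assumes "bij_betw a X X" "finite X" "x \<in> X" "y \<in> orbit a x"
  shows "orbit a y = orbit a x"
proof -
  have "x \<in> orbit a y"
    using self_in_orbit_bij_betw[OF assms(1-3)] assms(4) by (rule orbit_swap)
  then show ?thesis
    using assms(4) by (blast intro: orbit_trans)
qed

lemma commute_funpow_on:
  assumes "a \<in> X \<rightarrow> X" "\<forall>x\<in>X. b (a x) = a (b x)" "x \<in> X"
  shows "b ((a ^^ k) x) = (a ^^ k) (b x) \<and> (a ^^ k) x \<in> X"
  using assms by (induction k) auto

lemma image_orbit_commute:
  assumes "a \<in> X \<rightarrow> X" "\<forall>x\<in>X. b (a x) = a (b x)" "x \<in> X"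
  shows "b ` orbit a x = orbit a (b x)"
  using commute_funpow_on[OF assms] by (auto simp: orbit_altdef image_iff) metis+

text \<open>Modulo the powers of \<open>a\<close>, the maps \<open>b\<close>, \<open>c\<close>, \<open>d\<close> agree at \<open>x\<close>; the powers of \<open>a\<close> cancel in
  the commutator of \<open>b\<close> and \<open>c\<close> since \<open>d\<close> is central in \<open>\<langle>b, c, d\<rangle>\<close>.\<close>

lemma commute_if_same_orbit:
  assumes a: "a \<in> X \<rightarrow> X" and bcd: "b \<in> X \<rightarrow> X" "c \<in> X \<rightarrow> X" "d \<in> X \<rightarrow> X"
    and ab: "\<forall>x\<in>X. b (a x) = a (b x)" and ac: "\<forall>x\<in>X. c (a x) = a (c x)"
    and bd: "\<forall>x\<in>X. b (d x) = d (b x)" and cd: "\<forall>x\<in>X. c (d x) = d (c x)"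
    and ad: "\<forall>x\<in>X. d (a x) = a (d x)"
    and x: "x \<in> X" and orb: "b x \<in> orbit a (d x)" "c x \<in> orbit a (d x)"
  shows "b (c x) = c (b x)"
proof -
  obtain p q where p: "b x = (a ^^ p) (d x)" and q: "c x = (a ^^ q) (d x)"
    using orb by (auto simp: orbit_altdef)
  have dx: "d x \<in> X" "b x \<in> X" "c x \<in> X" using x bcd by auto
  note comm = commute_funpow_on[OF a ab] commute_funpow_on[OF a ac] commute_funpow_on[OF a ad]
  have "b (c x) = (a ^^ q) (d (b x))"
    using comm(1)[OF dx(1)] bd x by (simp add: q)
  also have "\<dots> = (a ^^ (q + p)) (d (d x))"
    using comm(3)[OF dx(1)] by (simp add: p funpow_add)
  also have "\<dots> = (a ^^ p) (d (c x))"
    using comm(3)[OF dx(1)] by (simp add: q funpow_add add.commute)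
  also have "\<dots> = c (b x)"
    using comm(2)[OF dx(1)] cd x by (simp add: p)
  finally show ?thesis .
qed

definition orbits_of_size :: "nat \<Rightarrow> ('a \<Rightarrow> 'a) \<Rightarrow> 'a set \<Rightarrow> 'a set set" where
  "orbits_of_size r a X = {orbit a x | x. x \<in> X \<and> card (orbit a x) = r}"

lemma orbits_of_sizeD:
  assumes "bij_betw a X X" "finite X" "P \<in> orbits_of_size r a X"
  shows "P \<subseteq> X" "card P = r" "x \<in> P \<Longrightarrow> orbit a x = P"
  using assms orbit_subset_bij_betw[OF assms(1)] orbit_eq_bij_betw[OF assms(1,2)]
  unfolding orbits_of_size_def by blast+

lemma finite_orbits_of_size:
  "finite X \<Longrightarrow> finite (orbits_of_size r a X)"
  by (simp add: orbits_of_size_def setcompr_eq_image)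

lemma card_Union_orbits_of_size:
  assumes "bij_betw a X X" "finite X"
  shows "card (\<Union>(orbits_of_size r a X)) = r * card (orbits_of_size r a X)"
proof -
  note D = orbits_of_sizeD[OF assms]
  have "r * card (orbits_of_size r a X) = card (\<Union>(orbits_of_size r a X))"
  proof (rule card_partition)
    show "finite (\<Union>(orbits_of_size r a X))"
      using assms(2) D(1) by (meson Union_least finite_subset)
    show "P \<inter> Q = {}" if "P \<in> orbits_of_size r a X" "Q \<in> orbits_of_size r a X" "P \<noteq> Q" for P Q
      using D(3)[OF that(1)] D(3)[OF that(2)] that(3) by auto
  qed (use finite_orbits_of_size[OF assms(2)] D(2) in auto)
  then show ?thesis by simp
qed

lemma Union_orbits_of_size:
  assumes "bij_betw a X X" "finite X"
  shows "\<Union>(orbits_of_size r a X) = {x \<in> X. card (orbit a x) = r}"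
proof (intro equalityI subsetI)
  fix x assume "x \<in> \<Union>(orbits_of_size r a X)"
  then obtain P where "P \<in> orbits_of_size r a X" "x \<in> P" by blast
  then show "x \<in> {x \<in> X. card (orbit a x) = r}"
    using orbits_of_sizeD[OF assms] by auto
next
  fix x assume "x \<in> {x \<in> X. card (orbit a x) = r}"
  then show "x \<in> \<Union>(orbits_of_size r a X)"
    using self_in_orbit_bij_betw[OF assms] unfolding orbits_of_size_def by blast
qed

lemma card_orbits_of_size_le:
  assumes "bij_betw a X X" "finite X"
  shows "r * card (orbits_of_size r a X) \<le> card X"
  using card_mono[of X "{x \<in> X. card (orbit a x) = r}"] assms(2)
    card_Union_orbits_of_size[OF assms, of r] Union_orbits_of_size[OF assms, of r] by simp

lemma image_orbits_of_size:
  assumes a: "bij_betw a X X" and X: "finite X" and b: "bij_betw b X X"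
    and ab: "\<forall>x\<in>X. b (a x) = a (b x)"
  shows "bij_betw (image b) (orbits_of_size r a X) (orbits_of_size r a X)"
proof -
  have "a \<in> X \<rightarrow> X" using a by (auto dest: bij_betwE)
  note im = image_orbit_commute[OF this ab]
  have "inj_on (image b) (orbits_of_size r a X)"
    using orbits_of_sizeD(1)[OF a X] bij_betw_imp_inj_on[OF b]
    by (intro inj_onI) (meson inj_on_image_eq_iff)
  moreover have "image b ` orbits_of_size r a X \<subseteq> orbits_of_size r a X"
  proof
    fix Q assume "Q \<in> image b ` orbits_of_size r a X"
    then obtain x where x: "x \<in> X" "card (orbit a x) = r" "Q = b ` orbit a x"
      by (auto simp: orbits_of_size_def)
    have "card (b ` orbit a x) = card (orbit a x)"
      using inj_on_subset[OF bij_betw_imp_inj_on[OF b] orbit_subset_bij_betw[OF a x(1)]]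
      by (rule card_image)
    then have "Q = orbit a (b x) \<and> b x \<in> X \<and> card (orbit a (b x)) = r"
      using x im[OF x(1)] bij_betw_apply[OF b x(1)] by simp
    then show "Q \<in> orbits_of_size r a X"
      unfolding orbits_of_size_def by (intro CollectI exI)
  qed
  ultimately show ?thesis
    using finite_orbits_of_size[OF X] by (simp add: bij_betw_def endo_inj_surj)
qed

section \<open>Braid group actions on finite sets\<close>

text \<open>A homomorphism from the braid group to the permutations of X, recorded by the images of
  the generators. All conditions concern points of X only, so that image maps on a set of orbits
  qualify although they need not permute the whole type.\<close>

definition braid_action :: "nat \<Rightarrow> 'a set \<Rightarrow> (nat \<Rightarrow> 'a \<Rightarrow> 'a) \<Rightarrow> bool" where
  "braid_action n X s \<longleftrightarrow> finite X \<and> (\<forall>i\<in>{1..<n}. bij_betw (s i) X X) \<and>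
    (\<forall>i x. 1 \<le> i \<longrightarrow> i + 1 < n \<longrightarrow> x \<in> X \<longrightarrow> s i (s (i + 1) (s i x)) = s (i + 1) (s i (s (i + 1) x))) \<and>
    (\<forall>i j x. 1 \<le> i \<longrightarrow> i + 1 < j \<longrightarrow> j < n \<longrightarrow> x \<in> X \<longrightarrow> s i (s j x) = s j (s i x))"

text \<open>The combinatorial form of a cyclic image: one permutation of X represents every
  generator.\<close>

definition collapsed :: "nat \<Rightarrow> 'a set \<Rightarrow> (nat \<Rightarrow> 'a \<Rightarrow> 'a) \<Rightarrow> bool" where
  "collapsed n X s \<longleftrightarrow> (\<forall>i\<in>{1..<n}. \<forall>j\<in>{1..<n}. \<forall>x\<in>X. s i x = s j x)"

lemma braid_actionD:
  assumes "braid_action n X s"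
  shows "finite X"
    and "1 \<le> i \<Longrightarrow> i < n \<Longrightarrow> bij_betw (s i) X X"
    and "1 \<le> i \<Longrightarrow> i < n \<Longrightarrow> x \<in> X \<Longrightarrow> s i x \<in> X"
    and "1 \<le> i \<Longrightarrow> i < n \<Longrightarrow> x \<in> X \<Longrightarrow> y \<in> X \<Longrightarrow> s i x = s i y \<longleftrightarrow> x = y"
    and "1 \<le> i \<Longrightarrow> i + 1 < n \<Longrightarrow> x \<in> X \<Longrightarrow> s i (s (i + 1) (s i x)) = s (i + 1) (s i (s (i + 1) x))"
    and "1 \<le> i \<Longrightarrow> i + 1 < j \<Longrightarrow> j < n \<Longrightarrow> x \<in> X \<Longrightarrow> s i (s j x) = s j (s i x)"
proof -
  show X: "finite X" and bij: "1 \<le> i \<Longrightarrow> i < n \<Longrightarrow> bij_betw (s i) X X"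
    using assms unfolding braid_action_def by simp_all
  show "1 \<le> i \<Longrightarrow> i < n \<Longrightarrow> x \<in> X \<Longrightarrow> s i x \<in> X"
    using bij by (rule bij_betw_apply)
  show "1 \<le> i \<Longrightarrow> i < n \<Longrightarrow> x \<in> X \<Longrightarrow> y \<in> X \<Longrightarrow> s i x = s i y \<longleftrightarrow> x = y"
    using inj_on_eq_iff[OF bij_betw_imp_inj_on[OF bij]] by simp
  show "1 \<le> i \<Longrightarrow> i + 1 < n \<Longrightarrow> x \<in> X \<Longrightarrow> s i (s (i + 1) (s i x)) = s (i + 1) (s i (s (i + 1) x))"
    and "1 \<le> i \<Longrightarrow> i + 1 < j \<Longrightarrow> j < n \<Longrightarrow> x \<in> X \<Longrightarrow> s i (s j x) = s j (s i x)"
    using assms unfolding braid_action_def by blast+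
qed

lemma braid_action_shift:
  assumes "braid_action n X s"
  shows "braid_action (n - k) X (\<lambda>i. s (i + k))"
  unfolding braid_action_def
proof (intro conjI allI ballI impI)
  fix i j x assume "1 \<le> i" "i + 1 < j" "j < n - k" "x \<in> X"
  then show "s (i + k) (s (j + k) x) = s (j + k) (s (i + k) x)"
    using braid_actionD(6)[OF assms, of "i + k" "j + k" x] by simp
qed (use braid_actionD[OF assms] in \<open>simp_all add: less_diff_conv\<close>)

text \<open>Commuting turns the left side of the braid relation into
  \<open>s (i + 1) (s i (s i x))\<close>, and the two outer maps cancel by injectivity.\<close>

lemma braid_action_commute_imp_eq:
  assumes s: "braid_action n X s" and i: "1 \<le> i" "i + 1 < n"
    and c: "\<And>x. x \<in> X \<Longrightarrow> s i (s (i + 1) x) = s (i + 1) (s i x)"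
  shows "\<forall>x\<in>X. s i x = s (i + 1) x"
proof
  fix x assume x: "x \<in> X"
  note D = braid_actionD[OF s]
  have "s (i + 1) (s i (s (i + 1) x)) = s i (s (i + 1) (s i x))"
    using D(5) i x by simp
  also have "\<dots> = s (i + 1) (s i (s i x))"
    using c D(3) i x by simp
  finally show "s i x = s (i + 1) x" using D(3,4) i x by simp
qed

text \<open>Generators i and i + 2 commute. If generator i + 1 equals one of them, it commutes with
  the other one, which is its neighbour, and commuting neighbours are equal.\<close>

lemma braid_action_step_eq:
  assumes s: "braid_action n X s" and i: "1 \<le> i" "i + 2 < n"
  shows "(\<forall>x\<in>X. s i x = s (i + 1) x) \<longleftrightarrow> (\<forall>x\<in>X. s (i + 1) x = s (i + 2) x)"
proof -
  note D = braid_actionD[OF s]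
  have two: "i + 2 = i + 1 + 1" by simp
  have c: "s i (s (i + 2) x) = s (i + 2) (s i x)" if "x \<in> X" for x
    using D(6)[of i "i + 2" x] i that by simp
  have in_X: "s i x \<in> X" "s (i + 1) x \<in> X" "s (i + 2) x \<in> X" if "x \<in> X" for x
    using D(3) i that by simp_all
  show ?thesis
  proof
    assume "\<forall>x\<in>X. s i x = s (i + 1) x"
    then have eq: "s (i + 1) (s (i + 2) x) = s (i + 2) (s (i + 1) x)" if "x \<in> X" for x
      using c[OF that] in_X[OF that] that by simp
    show "\<forall>x\<in>X. s (i + 1) x = s (i + 2) x"
      unfolding two by (rule braid_action_commute_imp_eq[OF s _ _ eq[unfolded two]]) (use i in simp_all)
  next
    assume "\<forall>x\<in>X. s (i + 1) x = s (i + 2) x"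
    then have eq: "s i (s (i + 1) x) = s (i + 1) (s i x)" if "x \<in> X" for x
      using c[OF that] in_X[OF that] that by simp
    show "\<forall>x\<in>X. s i x = s (i + 1) x"
      by (rule braid_action_commute_imp_eq[OF s _ _ eq]) (use i in simp_all)
  qed
qed

text \<open>One commuting pair of neighbours is enough, since equality of neighbours propagates
  along the chain in both directions. This is the source of every contradiction with a non-collapsed
  action.\<close>

lemma braid_action_collapsed:
  assumes s: "braid_action n X s" and i: "1 \<le> i" "i + 1 < n"
    and eq: "\<And>x. x \<in> X \<Longrightarrow> s i (s (i + 1) x) = s (i + 1) (s i x)"
  shows "collapsed n X s"
proof -
  define C where "C j \<longleftrightarrow> (\<forall>x\<in>X. s j x = s (j + 1) x)" for j
  have step: "C j \<longleftrightarrow> C (j + 1)" if "1 \<le> j" "j + 2 < n" for j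
    using braid_action_step_eq[OF s that] unfolding C_def by (simp add: add.assoc)
  have C1: "C j \<longleftrightarrow> C 1" if "1 \<le> j" "j + 1 < n" for j
    using that
  proof (induction j rule: nat_induct_at_least)
    case (Suc j)
    then show ?case using step[of j] by simp
  qed simp
  have "C i"
    unfolding C_def using braid_action_commute_imp_eq[OF s i eq] .
  then have C: "C j" if "1 \<le> j" "j + 1 < n" for j
    using C1[OF i] C1[OF that] by simp
  have "\<forall>x\<in>X. s j x = s 1 x" if "1 \<le> j" "j < n" for j
    using that
  proof (induction j rule: nat_induct_at_least)
    case (Suc j)
    then show ?case using C[of j] by (simp add: C_def)
  qed simp
  then show ?thesis
    unfolding collapsed_def by (metis atLeastLessThan_iff)
qed

text \<open>The product \<open>s\<^sub>i s\<^sub>i\<^sub>+\<^sub>1\<close> conjugates \<open>s\<^sub>i\<close> to \<open>s\<^sub>i\<^sub>+\<^sub>1\<close>.\<close>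

lemma braid_action_conj:
  assumes s: "braid_action n X s" and "1 \<le> i" "i < n" "1 \<le> j" "j < n"
  obtains g where "bij_betw g X X" "\<And>x. x \<in> X \<Longrightarrow> g (s i x) = s j (g x)"
proof -
  note D = braid_actionD[OF s]
  \<comment> \<open>It is enough to reach each generator from \<open>s 1\<close>; the passage from i
    to j then inverts one such map and applies another.\<close>
  have ex: "\<exists>g. bij_betw g X X \<and> (\<forall>x\<in>X. g (s 1 x) = s k (g x))" if "1 \<le> k" "k < n" for k
    using that
  proof (induction k rule: nat_induct_at_least)
    case base
    show ?case by (intro exI[of _ id] conjI bij_betw_id) simp
  next
    case (Suc k)
    then obtain g where g: "bij_betw g X X" "\<forall>x\<in>X. g (s 1 x) = s k (g x)" by auto
    have "bij_betw (\<lambda>x. s k (s (k + 1) (g x))) X X"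
      using bij_betw_trans[OF bij_betw_trans[OF g(1) D(2)[of "k + 1"]] D(2)[of k]] Suc
      by (simp add: comp_def)
    moreover have "s k (s (k + 1) (g (s 1 x))) = s (k + 1) (s k (s (k + 1) (g x)))" if "x \<in> X" for x
    proof -
      have "g x \<in> X" "g (s 1 x) = s k (g x)"
        using g that by (auto intro: bij_betw_apply)
      then show ?thesis using D(5)[of k "g x"] Suc by simp
    qed
    ultimately show ?case
      by (intro exI[of _ "\<lambda>x. s k (s (k + 1) (g x))"]) simp
  qed
  obtain g where g: "bij_betw g X X" "\<forall>x\<in>X. g (s 1 x) = s i (g x)" using ex assms by blast
  obtain h where h: "bij_betw h X X" "\<forall>x\<in>X. h (s 1 x) = s j (h x)" using ex assms by blast
  have inv: "bij_betw (inv_into X g) X X" using g(1) by (rule bij_betw_inv_into)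
  have "h (inv_into X g (s i x)) = s j (h (inv_into X g x))" if "x \<in> X" for x
  proof -
    have y: "inv_into X g x \<in> X" "g (inv_into X g x) = x"
      using inv g(1) that by (auto dest: bij_betwE simp: bij_betw_inv_into_right)
    then have "s i x = g (s 1 (inv_into X g x))" using g(2) by simp
    then have "inv_into X g (s i x) = s 1 (inv_into X g x)"
      using bij_betw_inv_into_left[OF g(1)] D(3)[of 1] y(1) assms by simp
    then show ?thesis using h(2) y by simp
  qed
  moreover have "bij_betw (h \<circ> inv_into X g) X X"
    using inv h(1) by (rule bij_betw_trans)
  ultimately show ?thesis using that[of "h \<circ> inv_into X g"] by simp
qed

lemma braid_action_moved_conj:
  assumes s: "braid_action n X s" and "1 \<le> i" "i < n" "1 \<le> j" "j < n"
  shows "card {x \<in> X. s i x \<noteq> x} = card {x \<in> X. s j x \<noteq> x}"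
proof -
  obtain g where g: "bij_betw g X X" "\<And>x. x \<in> X \<Longrightarrow> g (s i x) = s j (g x)"
    using braid_action_conj[OF assms] by blast
  have inj: "g x = g y \<longleftrightarrow> x = y" if "x \<in> X" "y \<in> X" for x y
    using bij_betw_imp_inj_on[OF g(1)] that by (auto simp: inj_on_def)
  have eq: "s j (g x) \<noteq> g x \<longleftrightarrow> s i x \<noteq> x" if "x \<in> X" for x
  proof -
    have "s i x \<in> X" using braid_actionD(3)[OF s] assms that by blast
    then show ?thesis using g(2)[OF that] inj[of "s i x" x] that by simp
  qed
  have "{x \<in> X. s j x \<noteq> x} = {x \<in> g ` X. s j x \<noteq> x}"
    using bij_betw_imp_surj_on[OF g(1)] by simp
  also have "\<dots> = g ` {x \<in> X. s i x \<noteq> x}"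
    using eq by auto
  finally have "g ` {x \<in> X. s i x \<noteq> x} = {x \<in> X. s j x \<noteq> x}" by simp
  then show ?thesis
    using card_image[of g "{x \<in> X. s i x \<noteq> x}"] bij_betw_imp_inj_on[OF g(1)]
    by (metis (mono_tags, lifting) inj_on_subset mem_Collect_eq subsetI)
qed

lemma braid_action_funpow_conj:
  assumes s: "braid_action n X s" and ij: "1 \<le> i" "i < n" "1 \<le> j" "j < n"
    and k: "\<And>x. x \<in> X \<Longrightarrow> (s i ^^ k) x = x" and x: "x \<in> X"
  shows "(s j ^^ k) x = x"
proof -
  obtain g where g: "bij_betw g X X" "\<And>x. x \<in> X \<Longrightarrow> g (s i x) = s j (g x)"
    using braid_action_conj[OF s ij] by blast
  obtain y where y: "y \<in> X" "x = g y" using bij_betw_imp_surj_on[OF g(1)] x by blast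
  have "g ((s i ^^ m) y) = (s j ^^ m) (g y) \<and> (s i ^^ m) y \<in> X" for m
    using braid_actionD(3)[OF s ij(1,2)] y(1) g(2) by (induction m) auto
  then show ?thesis using k[OF y(1)] y(2) by metis
qed

section \<open>Supports, and generators acting as transpositions\<close>

definition moved :: "'a set \<Rightarrow> ('a \<Rightarrow> 'a) \<Rightarrow> 'a set" where
  "moved X f = {x \<in> X. f x \<noteq> x}"

lemma card_moved_conj:
  assumes s: "braid_action n X s" and "1 \<le> i" "i < n" "1 \<le> j" "j < n"
  shows "card (moved X (s i)) = card (moved X (s j))"
  unfolding moved_def using braid_action_moved_conj[OF assms] .

lemma bij_betw_moved:
  assumes "bij_betw f X X" "x \<in> moved X f"
  shows "f x \<in> moved X f"
  using assms unfolding moved_def bij_betw_def inj_on_def by blast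

lemma card_moved_neq_1:
  assumes "bij_betw f X X"
  shows "card (moved X f) \<noteq> 1"
proof
  assume "card (moved X f) = 1"
  then obtain x where x: "moved X f = {x}" by (auto simp: card_1_singleton_iff)
  then have "f x \<in> {x}" using bij_betw_moved[OF assms] by blast
  moreover have "f x \<noteq> x" using x unfolding moved_def by blast
  ultimately show False by simp
qed

lemma moved_pair_swap:
  assumes "bij_betw f X X" "moved X f = {p, q}"
  shows "f p = q" "f q = p"
proof -
  have "f p \<noteq> p" "f q \<noteq> q" using assms(2) unfolding moved_def by auto
  moreover have "f p \<in> {p, q}" "f q \<in> {p, q}"
    using bij_betw_moved[OF assms(1)] assms(2) by blast+
  ultimately show "f p = q" "f q = p" by auto
qed

lemma not_moved: "x \<in> X \<Longrightarrow> x \<notin> moved X f \<Longrightarrow> f x = x"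
  by (simp add: moved_def)

lemma card_2_obtain:
  assumes "card S = 2" "z \<in> S"
  obtains w where "S = {z, w}" "z \<noteq> w"
proof -
  obtain p q where "S = {p, q}" "p \<noteq> q" using assms(1) by (auto simp: card_2_iff)
  then show ?thesis using that[of p] that[of q] assms(2) by (cases "z = p") auto
qed

text \<open>If the second points w of f and v of g differed, then \<open>f (g z)\<close> would be v
  and \<open>g (f z)\<close> would be w.\<close>

lemma commuting_swaps_eq:
  assumes f: "bij_betw f X X" "card (moved X f) = 2" and g: "bij_betw g X X" "card (moved X g) = 2"
    and comm: "\<forall>x\<in>X. f (g x) = g (f x)" and z: "z \<in> moved X f" "z \<in> moved X g"
  shows "\<forall>x\<in>X. f x = g x"
proof -
  obtain w where w: "moved X f = {z, w}" "z \<noteq> w"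
    using card_2_obtain[OF f(2) z(1)] .
  obtain v where v: "moved X g = {z, v}" "z \<noteq> v"
    using card_2_obtain[OF g(2) z(2)] .
  note sw = moved_pair_swap[OF f(1) w(1)] moved_pair_swap[OF g(1) v(1)]
  have X: "z \<in> X" "w \<in> X" "v \<in> X" using w v unfolding moved_def by blast+
  have "v = w"
  proof (rule ccontr)
    assume "v \<noteq> w"
    then have "f v = v" "g w = w" using w v X not_moved[of v X f] not_moved[of w X g] by auto
    moreover have "f (g z) = g (f z)" using comm X by blast
    ultimately show False using sw \<open>v \<noteq> w\<close> by simp
  qed
  show ?thesis
  proof
    fix x assume "x \<in> X"
    then show "f x = g x"
      using sw \<open>v = w\<close> w v not_moved[of x X f] not_moved[of x X g] by (cases "x = z \<or> x = w") auto
  qed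
qed

lemma disjoint_swaps_commute:
  assumes f: "bij_betw f X X" and g: "bij_betw g X X"
    and disj: "moved X f \<inter> moved X g = {}" and x: "x \<in> X"
  shows "f (g x) = g (f x)"
proof -
  have X: "f x \<in> X" "g x \<in> X" using f g x by (auto intro: bij_betw_apply)
  consider "x \<in> moved X f" | "x \<in> moved X g" | "x \<notin> moved X f" "x \<notin> moved X g" by blast
  then show ?thesis
  proof cases
    case 1
    then have "f x \<notin> moved X g" "x \<notin> moved X g" using bij_betw_moved[OF f] disj by blast+
    then show ?thesis using not_moved X x by metis
  next
    case 2
    then have "g x \<notin> moved X f" "x \<notin> moved X f" using bij_betw_moved[OF g] disj by blast+
    then show ?thesis using not_moved X x by metis
  next
    case 3
    then show ?thesis using not_moved x by metis
  qed
qed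

text \<open>One looks for a generator that is a neighbour of one of i, j and distant from the other:
  the equality makes it commute with its neighbour. The candidates i - 1, j + 1 and i + 1 all fail
  only for i = 1, j = 3 and n = 4.\<close>

lemma braid_action_distant_eq_collapsed:
  assumes s: "braid_action n X s" and ij: "1 \<le> i" "i + 1 < j" "j < n" and n: "n \<noteq> 4"
    and eq: "\<forall>x\<in>X. s i x = s j x"
  shows "collapsed n X s"
proof -
  note D = braid_actionD[OF s]
  consider "i \<ge> 2" | "j + 1 < n" | "i = 1" "j \<ge> 4" using ij n by linarith
  then show ?thesis
  proof cases
    case 1
    define k where "k = i - 1"
    have k: "1 \<le> k" "k + 1 = i" "k + 1 < j" using 1 ij by (simp_all add: k_def)
    have "s k (s (k + 1) x) = s (k + 1) (s k x)" if x: "x \<in> X" for x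
    proof -
      have "s k (s i x) = s k (s j x)" using eq x by simp
      also have "\<dots> = s j (s k x)" by (rule D(6)) (use k ij x in auto)
      also have "\<dots> = s i (s k x)" using eq D(3)[of k x] k ij x by simp
      finally show ?thesis using k by simp
    qed
    moreover have "k + 1 < n" using k ij by linarith
    ultimately show ?thesis using braid_action_collapsed[OF s k(1)] by blast
  next
    case 2
    have "s j (s (j + 1) x) = s (j + 1) (s j x)" if x: "x \<in> X" for x
    proof -
      have "s j (s (j + 1) x) = s i (s (j + 1) x)" using eq D(3)[of "j + 1" x] 2 x by simp
      also have "\<dots> = s (j + 1) (s i x)" by (rule D(6)) (use 2 ij x in auto)
      also have "\<dots> = s (j + 1) (s j x)" using eq x by simp
      finally show ?thesis .
    qed
    moreover have "1 \<le> j" using ij by linarith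
    ultimately show ?thesis using braid_action_collapsed[OF s _ 2] by blast
  next
    case 3
    have "s i (s (i + 1) x) = s (i + 1) (s i x)" if x: "x \<in> X" for x
    proof -
      have "s i (s (i + 1) x) = s j (s (i + 1) x)" using eq D(3)[of "i + 1" x] 3 ij x by simp
      also have "\<dots> = s (i + 1) (s j x)" by (rule D(6)[symmetric]) (use 3 ij x in auto)
      also have "\<dots> = s (i + 1) (s i x)" using eq x by simp
      finally show ?thesis .
    qed
    moreover have "i + 1 < n" using ij by linarith
    ultimately show ?thesis using braid_action_collapsed[OF s ij(1)] by blast
  qed
qed

text \<open>If the generators act as transpositions, then consecutive ones meet in one point and distant
  ones are disjoint; \<open>h i\<close> is the common point of the supports of \<open>s (i - 1)\<close> and \<open>s i\<close>.\<close>

lemma braid_action_transpositions: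
  assumes s: "braid_action n X s" and n: "3 \<le> n" "n \<noteq> 4" and nc: "\<not> collapsed n X s"
    and two: "card (moved X (s 1)) = 2"
  obtains h where "inj_on h {1..n}" "h ` {1..n} \<subseteq> X"
    "\<And>i. 1 \<le> i \<Longrightarrow> i < n \<Longrightarrow> moved X (s i) = {h i, h (i + 1)}"
proof -
  note D = braid_actionD[OF s]
  define M where "M i = moved X (s i)" for i
  have card: "card (M i) = 2" if "1 \<le> i" "i < n" for i
    using card_moved_conj[OF s that, of 1] two n by (simp add: M_def)
  have pair: "M i = {p, q}" if "1 \<le> i" "i < n" "p \<in> M i" "q \<in> M i" "p \<noteq> q" for i p q
    using card[OF that(1,2)] that(3-5) by (auto simp: card_2_iff)
  \<comment> \<open>A common point would make the two commuting transpositions equal, and equal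
    distant generators collapse the action.\<close>
  have far: "M i \<inter> M j = {}" if ij: "1 \<le> i" "i + 1 < j" "j < n" for i j
  proof (rule ccontr)
    assume "M i \<inter> M j \<noteq> {}"
    then obtain z where z: "z \<in> moved X (s i)" "z \<in> moved X (s j)" by (auto simp: M_def)
    have i: "i < n" and j: "1 \<le> j" using ij by auto
    have "\<forall>x\<in>X. s i (s j x) = s j (s i x)" using D(6)[OF ij] by blast
    then have "\<forall>x\<in>X. s i x = s j x"
      using commuting_swaps_eq[OF D(2)[OF ij(1) i] _ D(2)[OF j ij(3)] _ _ z]
        card[OF ij(1) i] card[OF j ij(3)] by (simp add: M_def)
    then show False using braid_action_distant_eq_collapsed[OF s ij n(2)] nc by blast
  qed
  have near: "M i \<inter> M (i + 1) \<noteq> {} \<and> M i \<noteq> M (i + 1)" if i: "1 \<le> i" "i + 1 < n" for i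
  proof -
    have bij: "bij_betw (s i) X X" "bij_betw (s (i + 1)) X X" using D(2) i by simp_all
    have ne: "\<not> (\<forall>x\<in>X. s i (s (i + 1) x) = s (i + 1) (s i x))"
      using braid_action_collapsed[OF s i] nc by blast
    moreover have "M i \<noteq> M (i + 1)"
    proof
      assume eq: "M i = M (i + 1)"
      obtain p q where "M i = {p, q}" using card[of i] i by (auto simp: card_2_iff)
      then have pq: "moved X (s i) = {p, q}" "moved X (s (i + 1)) = {p, q}"
        using eq by (simp_all add: M_def)
      note sw = moved_pair_swap[OF bij(1) pq(1)] moved_pair_swap[OF bij(2) pq(2)]
      have "s i x = s (i + 1) x" if "x \<in> X" for x
        using sw pq not_moved[OF that, of "s i"] not_moved[OF that, of "s (i + 1)"]
        by (cases "x \<in> {p, q}") auto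
      moreover have "s i x \<in> X" "s (i + 1) x \<in> X" if "x \<in> X" for x
        using D(3) i that by simp_all
      ultimately show False using ne by simp
    qed
    ultimately show ?thesis
      using disjoint_swaps_commute[OF bij] unfolding M_def by blast
  qed
  define c where "c i = (SOME z. z \<in> M (i - 1) \<inter> M i)" for i
  have c: "c i \<in> M (i - 1)" "c i \<in> M i" if "2 \<le> i" "i < n" for i
  proof -
    have "1 \<le> i - 1" "i - 1 + 1 = i" using that by linarith+
    then have "\<exists>z. z \<in> M (i - 1) \<inter> M i" using near[of "i - 1"] that by auto
    then have "c i \<in> M (i - 1) \<inter> M i" unfolding c_def by (rule someI_ex)
    then show "c i \<in> M (i - 1)" "c i \<in> M i" by auto
  qed
  have other: "\<exists>z. z \<in> M i \<and> z \<noteq> y" if "1 \<le> i" "i < n" for i y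
    using card[OF that] by (auto simp: card_2_iff)
  \<comment> \<open>The ends of the chain lie in a single support each: they are the points of the
    first and of the last support that are not shared with the next one.\<close>
  obtain a where a: "a \<in> M 1" "a \<noteq> c 2" using other[of 1 "c 2"] n by auto
  obtain b where b: "b \<in> M (n - 1)" "b \<noteq> c (n - 1)"
  proof -
    have "1 \<le> n - 1" "n - 1 < n" using n by linarith+
    then show ?thesis using other[of "n - 1" "c (n - 1)"] that by blast
  qed
  define h where "h i = (if i = 1 then a else if i = n then b else c i)" for i
  have h: "h i \<in> M i" "h (i + 1) \<in> M i" "h i \<noteq> h (i + 1)" if i: "1 \<le> i" "i < n" for i
  proof -
    show "h i \<in> M i" using a c[of i] i by (auto simp: h_def)
    show "h (i + 1) \<in> M i" using b c[of "i + 1"] i by (auto simp: h_def)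
    consider "i = 1" | "i = n - 1" "i \<noteq> 1" | "2 \<le> i" "i + 1 < n" using i by linarith
    then show "h i \<noteq> h (i + 1)"
    proof cases
      case 1
      then show ?thesis using a n by (simp add: h_def numeral_2_eq_2)
    next
      case 2
      then show ?thesis using b n by (auto simp: h_def)
    next
      case 3
      then have "M (i - 1) \<inter> M (i + 1) = {}" by (intro far) auto
      moreover have "c i \<in> M (i - 1)" "c (i + 1) \<in> M (i + 1)" using c 3 by auto
      ultimately show ?thesis using 3 by (auto simp: h_def)
    qed
  qed
  have M: "M i = {h i, h (i + 1)}" if "1 \<le> i" "i < n" for i
    using pair[OF that h[OF that]] .
  \<comment> \<open>At distance two, equality would make two neighbouring supports equal; at larger
    distance the points lie in the disjoint supports \<open>M i\<close> and
    \<open>M (j - 1)\<close>.\<close>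
  have neq: "h i \<noteq> h j" if ij: "1 \<le> i" "i < j" "j \<le> n" for i j
  proof -
    consider "j = i + 1" | "j = i + 2" | "i + 1 < j - 1" using ij by linarith
    then show ?thesis
    proof cases
      case 1
      then show ?thesis using h[of i] ij by simp
    next
      case 2
      then show ?thesis using M[of i] M[of "i + 1"] near[of i] ij by auto
    next
      case 3
      then show ?thesis using far[of i "j - 1"] M[of i] M[of "j - 1"] ij by auto
    qed
  qed
  have "inj_on h {1..n}"
  proof (rule inj_onI)
    fix i j assume "i \<in> {1..n}" "j \<in> {1..n}" "h i = h j"
    then show "i = j" using neq[of i j] neq[of j i] by (cases i j rule: linorder_cases) auto
  qed
  moreover have hX: "h i \<in> X" if "i \<in> {1..n}" for i
  proof (cases "i = n")
    case True
    then have "h i \<in> M (n - 1)" using h(2)[of "n - 1"] n by simp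
    then show ?thesis by (simp add: M_def moved_def)
  next
    case False
    then have "h i \<in> M i" using h(1)[of i] that by simp
    then show ?thesis by (simp add: M_def moved_def)
  qed
  moreover have "h ` {1..n} \<subseteq> X" using hX by blast
  ultimately show thesis using that[of h] M by (simp add: M_def)
qed

section \<open>Permutations of two and of three points\<close>

lemma bij_betw_card_le_2:
  assumes f: "bij_betw f Y Y" and g: "bij_betw g Y Y" and Y: "finite Y" "card Y \<le> 2" and y: "y \<in> Y"
  shows "f (g y) = g (f y)" "f (f y) = y"
proof -
  have "card Y \<noteq> 0" using Y y by auto
  then consider "card Y = 1" | "card Y = 2" using Y(2) by linarith
  then have "f (g y) = g (f y) \<and> f (f y) = y"
  proof cases
    case 1
    then obtain z where "Y = {z}" by (auto simp: card_1_singleton_iff)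
    then show ?thesis using y f g by (auto simp: bij_betw_def)
  next
    case 2
    then obtain p q where pq: "Y = {p, q}" "p \<noteq> q" by (auto simp: card_2_iff)
    have "(f p = p \<and> f q = q) \<or> (f p = q \<and> f q = p)" if f: "bij_betw f Y Y" for f
    proof -
      have "f p \<in> {p, q}" "f q \<in> {p, q}"
        using bij_betw_apply[OF f, of p] bij_betw_apply[OF f, of q] pq(1) by simp_all
      moreover have "f p \<noteq> f q"
        using bij_betw_imp_inj_on[OF f] pq by (simp add: inj_on_eq_iff)
      ultimately show ?thesis by auto
    qed
    note this[OF f] this[OF g]
    moreover have "y = p \<or> y = q" using y pq(1) by simp
    ultimately show ?thesis by (elim disjE conjE) simp_all
  qed
  then show "f (g y) = g (f y)" "f (f y) = y" by auto
qed

lemma bij_betw_cube_cases: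
  assumes f: "bij_betw f {p, q, r} {p, q, r}" and d: "distinct [p, q, r]"
    and cube: "\<forall>x\<in>{p, q, r}. f (f (f x)) = x"
  shows "(f p = p \<and> f q = q \<and> f r = r) \<or> (f p = q \<and> f q = r \<and> f r = p) \<or> (f p = r \<and> f q = p \<and> f r = q)"
proof -
  have "f p \<in> {p, q, r}" "f q \<in> {p, q, r}" "f r \<in> {p, q, r}" using bij_betwE[OF f] by auto
  moreover have "inj_on f {p, q, r}" using f by (rule bij_betw_imp_inj_on)
  ultimately show ?thesis using d cube by (auto simp: inj_on_def)
qed

text \<open>A permutation of three points with trivial cube is a rotation, and the rotations form a
  cyclic group.\<close>

lemma bij_betw_cube_commute:
  assumes f: "bij_betw f Y Y" and g: "bij_betw g Y Y" and Y: "card Y = 3"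
    and "\<forall>x\<in>Y. f (f (f x)) = x" "\<forall>x\<in>Y. g (g (g x)) = x" and y: "y \<in> Y"
  shows "f (g y) = g (f y)"
proof -
  obtain p q r where Y: "Y = {p, q, r}" "distinct [p, q, r]" using Y by (auto simp: card_3_iff)
  show ?thesis
    using bij_betw_cube_cases[of f p q r] bij_betw_cube_cases[of g p q r] assms Y
    by auto
qed

lemma bij_betw_moved_3_cube:
  assumes f: "bij_betw f X X" and M: "card (moved X f) = 3" and x: "x \<in> X"
  shows "f (f (f x)) = x"
proof (cases "x \<in> moved X f")
  case True
  obtain p q r where Y: "moved X f = {p, q, r}" "distinct [p, q, r]" using M by (auto simp: card_3_iff)
  have "f p \<in> {p, q, r}" "f q \<in> {p, q, r}" "f r \<in> {p, q, r}"
    using bij_betw_moved[OF f] Y by auto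
  moreover have "f p \<noteq> p" "f q \<noteq> q" "f r \<noteq> r"
    using Y unfolding moved_def by blast+
  moreover have "inj_on f {p, q, r}"
    using bij_betw_imp_inj_on[OF f] inj_on_subset[of f X "moved X f"] Y by (auto simp: moved_def)
  ultimately show ?thesis using True Y by (auto simp: inj_on_def)
next
  case False
  then show ?thesis using x by (simp add: moved_def)
qed

section \<open>The action of commuting generators on orbits\<close>

lemma braid_action_orbits:
  assumes t: "braid_action n X t" and a: "bij_betw a X X"
    and ta: "\<And>i. 1 \<le> i \<Longrightarrow> i < n \<Longrightarrow> \<forall>x\<in>X. t i (a x) = a (t i x)"
  shows "braid_action n (orbits_of_size r a X) (\<lambda>i. image (t i))"
  unfolding braid_action_def
proof (intro conjI allI ballI impI)
  note D = braid_actionD[OF t]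
  show "finite (orbits_of_size r a X)" using finite_orbits_of_size D(1) .
  show "bij_betw (image (t i)) (orbits_of_size r a X) (orbits_of_size r a X)" if "i \<in> {1..<n}" for i
    using image_orbits_of_size[OF a D(1,2) ta] that by simp
  note sub = orbits_of_sizeD(1)[OF a D(1)]
  show "t i ` t (i + 1) ` t i ` P = t (i + 1) ` t i ` t (i + 1) ` P"
    if "1 \<le> i" "i + 1 < n" "P \<in> orbits_of_size r a X" for i P
    unfolding image_image using D(5)[OF that(1,2)] sub[OF that(3)] by (intro image_cong) auto
  show "t i ` t j ` P = t j ` t i ` P"
    if "1 \<le> i" "i + 1 < j" "j < n" "P \<in> orbits_of_size r a X" for i j P
    unfolding image_image using D(6)[OF that(1-3)] sub[OF that(4)] by (intro image_cong) auto
qed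

text \<open>Translates equal actions on the set of orbits into equality at x modulo powers of a, the
  form required by \<open>commute_if_same_orbit\<close>.\<close>

lemma mem_orbit_if_image_eq:
  assumes a: "bij_betw a X X" "finite X" and b: "b \<in> X \<rightarrow> X" "\<forall>x\<in>X. b (a x) = a (b x)"
    and c: "c \<in> X \<rightarrow> X" "\<forall>x\<in>X. c (a x) = a (c x)" and x: "x \<in> X"
    and eq: "b ` orbit a x = c ` orbit a x"
  shows "b x \<in> orbit a (c x)"
proof -
  have aX: "a \<in> X \<rightarrow> X" using a(1) by (auto dest: bij_betwE)
  have "b x \<in> orbit a (b x)" using self_in_orbit_bij_betw[OF a] b(1) x by blast
  also have "\<dots> = orbit a (c x)"
    using eq image_orbit_commute[OF aX b(2) x] image_orbit_commute[OF aX c(2) x] by simp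
  finally show ?thesis .
qed

lemma fixed_points_eq_orbits_of_size_1:
  assumes "bij_betw a X X" "finite X"
  shows "{x \<in> X. card (orbit a x) = 1} = X - moved X a"
proof -
  have "card (orbit a x) = 1 \<longleftrightarrow> a x = x" if "x \<in> X" for x
  proof
    assume "card (orbit a x) = 1"
    then have "orbit a x = {x}"
      using self_in_orbit_bij_betw[OF assms that] by (auto simp: card_1_singleton_iff)
    then show "a x = x" by (simp add: orbit_eq_singleton_iff)
  next
    assume "a x = x"
    then show "card (orbit a x) = 1" by (simp flip: orbit_eq_singleton_iff)
  qed
  then show ?thesis by (auto simp: moved_def)
qed

lemma card_moved:
  assumes "bij_betw a X X" "finite X"
  shows "card (moved X a) + card (orbits_of_size 1 a X) = card X"
proof -
  have "moved X a \<subseteq> X" by (auto simp: moved_def)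
  then have "card (X - moved X a) + card (moved X a) = card X"
    using assms(2) by (metis card_Diff_subset card_mono finite_subset le_add_diff_inverse2)
  then show ?thesis
    using card_Union_orbits_of_size[OF assms, of 1]
    unfolding Union_orbits_of_size[OF assms] fixed_points_eq_orbits_of_size_1[OF assms] by simp
qed

text \<open>The later induction ranges over actions on sets of natural numbers, while its step
  produces an action on a set of orbits, whose elements have another type. Numbering the orbits
  brings it back.\<close>

lemma braid_action_transport:
  assumes t: "braid_action n Y t"
  obtains t' where "braid_action n {..<card Y} t'" "collapsed n {..<card Y} t' \<Longrightarrow> collapsed n Y t"
proof -
  note D = braid_actionD[OF t]
  obtain h where h: "bij_betw h Y {..<card Y}"
    using ex_bij_betw_finite_nat[OF D(1)] by (auto simp: atLeast0LessThan)
  define g where "g = inv_into Y h"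
  have g: "bij_betw g {..<card Y} Y" using h unfolding g_def by (rule bij_betw_inv_into)
  have gh: "g (h y) = y" if "y \<in> Y" for y using bij_betw_inv_into_left[OF h that] by (simp add: g_def)
  have gY: "g k \<in> Y" if "k \<in> {..<card Y}" for k using bij_betw_apply[OF g that] .
  define t' where "t' i k = h (t i (g k))" for i k
  have "braid_action n {..<card Y} t'"
    unfolding braid_action_def
  proof (intro conjI allI ballI impI)
    fix i assume "i \<in> {1..<n}"
    then have "bij_betw (h \<circ> (t i \<circ> g)) {..<card Y} {..<card Y}"
      using bij_betw_trans[OF bij_betw_trans[OF g D(2)] h] by simp
    moreover have "h \<circ> (t i \<circ> g) = t' i" by (simp add: t'_def fun_eq_iff)
    ultimately show "bij_betw (t' i) {..<card Y} {..<card Y}" by simp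
  next
    fix i j x assume ij: "1 \<le> i" "i + 1 < j" "j < n" and x: "x \<in> {..<card Y}"
    then have "t i (g x) \<in> Y" "t j (g x) \<in> Y" using D(3) gY by auto
    then show "t' i (t' j x) = t' j (t' i x)"
      using D(6)[OF ij gY[OF x]] by (simp add: t'_def gh)
  qed (use D gh gY in \<open>simp_all add: t'_def\<close>)
  moreover have "collapsed n Y t" if "collapsed n {..<card Y} t'"
    unfolding collapsed_def
  proof (intro ballI)
    fix i j y assume ij: "i \<in> {1..<n}" "j \<in> {1..<n}" and y: "y \<in> Y"
    have "h y \<in> {..<card Y}" using bij_betw_apply[OF h y] .
    then have "h (t i y) = h (t j y)"
      using that ij gh[OF y] unfolding collapsed_def t'_def by metis
    then show "t i y = t j y"
      using gh D(3) ij y by (metis atLeastLessThan_iff)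
  qed
  ultimately show thesis using that by blast
qed

lemma card_2_orbit:
  assumes "bij_betw a X X" "finite X" "x \<in> X" "card (orbit a x) = 2"
  shows "a x \<noteq> x" "a (a x) = x" "orbit a x = {x, a x}"
proof -
  have ne: "a x \<noteq> x" using assms(4) orbit_eq_singleton_iff[of a x] by auto
  have mem: "x \<in> orbit a x" "a x \<in> orbit a x" "a (a x) \<in> orbit a x"
    using self_in_orbit_bij_betw[OF assms(1-3)] by (auto intro: orbit.intros)
  show eq: "orbit a x = {x, a x}"
    using card_2_obtain[OF assms(4) mem(1)] mem(2) ne by auto
  have "a (a x) \<noteq> a x"
    using ne bij_betw_imp_inj_on[OF assms(1)] bij_betw_apply[OF assms(1,3)] assms(3)
    by (auto simp: inj_on_eq_iff)
  then show "a (a x) = x" using mem(3) eq by auto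
  show "a x \<noteq> x" by fact
qed

text \<open>With at most two 2-cycles in \<open>a\<close>, both generators act on these in the same way, and since
  the powers of \<open>a\<close> by which they differ are determined by a parity, the braid relation forces
  them to agree.\<close>

lemma braid_action_two_2_cycles:
  assumes t: "braid_action 3 X t" and a: "bij_betw a X X"
    and ta: "\<And>i. 1 \<le> i \<Longrightarrow> i < 3 \<Longrightarrow> \<forall>x\<in>X. t i (a x) = a (t i x)"
    and two: "card (orbits_of_size 2 a X) \<le> 2"
    and x: "x \<in> X" "card (orbit a x) = 2"
  shows "t 1 (t 2 x) = t 2 (t 1 x)"
proof -
  note D = braid_actionD[OF t]
  define b c where "b = t 1" and "c = t 2"
  define Y where "Y = {x \<in> X. card (orbit a x) = 2}"
  let ?O = "orbits_of_size 2 a X"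
  have X: "finite X" by (fact D(1))
  have aX: "a \<in> X \<rightarrow> X" using a by (auto dest: bij_betwE)
  have b: "bij_betw b X X" "\<forall>x\<in>X. b (a x) = a (b x)" and c: "bij_betw c X X" "\<forall>x\<in>X. c (a x) = a (c x)"
    using D(2)[of 1] D(2)[of 2] ta[of 1] ta[of 2] by (auto simp: b_def c_def)
  have bX: "b \<in> X \<rightarrow> X" and cX: "c \<in> X \<rightarrow> X" using b(1) c(1) by (auto dest: bij_betwE)
  have braid: "b (c (b z)) = c (b (c z))" if "z \<in> X" for z
    using D(5)[of 1 z] that by (simp add: b_def c_def numeral_2_eq_2)
  have O: "braid_action 3 ?O (\<lambda>i. image (t i))" by (rule braid_action_orbits[OF t a ta])
  note OD = braid_actionD[OF O]
  have O_bij: "bij_betw (image b) ?O ?O" "bij_betw (image c) ?O ?O"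
    using OD(2)[of 1] OD(2)[of 2] by (auto simp: b_def c_def)
  \<comment> \<open>Permutations of at most two 2-cycles commute, and commuting neighbours
    agree.\<close>
  have "\<forall>P\<in>?O. t 1 ` P = t (1 + 1) ` P"
    by (rule braid_action_commute_imp_eq[OF O])
      (use bij_betw_card_le_2(1)[OF O_bij OD(1) two] in \<open>simp_all add: b_def c_def numeral_2_eq_2\<close>)
  then have O_eq: "b ` P = c ` P" if "P \<in> ?O" for P
    using that by (simp add: b_def c_def numeral_2_eq_2)
  have orb: "orbit a z \<in> ?O" if "z \<in> Y" for z
    using that by (auto simp: Y_def orbits_of_size_def)
  have aY: "a z \<noteq> z" "a (a z) = z" "orbit a z = {z, a z}" "z \<in> X" if "z \<in> Y" for z
    using card_2_orbit[OF a X] that by (auto simp: Y_def)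
  have Y_mem: "z \<in> Y" if "orbit a z \<in> ?O" "z \<in> X" for z
    using orbits_of_sizeD(2)[OF a X that(1)] that(2) by (simp add: Y_def)
  have bY: "b z \<in> Y" if z: "z \<in> Y" for z
    using bij_betw_apply[OF O_bij(1) orb[OF z]] image_orbit_commute[OF aX b(2) aY(4)[OF z]]
      Y_mem[of "b z"] bX aY(4)[OF z] by auto
  have cY: "c z \<in> Y" if z: "z \<in> Y" for z
    using bij_betw_apply[OF O_bij(2) orb[OF z]] image_orbit_commute[OF aX c(2) aY(4)[OF z]]
      Y_mem[of "c z"] cX aY(4)[OF z] by auto
  have cb: "c z = b z \<or> c z = a (b z)" if z: "z \<in> Y" for z
  proof -
    have "c z \<in> orbit a (b z)"
      by (rule mem_orbit_if_image_eq[OF a X cX c(2) bX b(2) aY(4)[OF z] O_eq[OF orb[OF z], symmetric]])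
    then show ?thesis using aY(3)[OF bY[OF z]] by simp
  qed
  have bb: "b (b z) = z \<or> b (b z) = a z" if z: "z \<in> Y" for z
  proof -
    have "orbit a (b (b z)) = b ` b ` orbit a z"
      using image_orbit_commute[OF aX b(2)] aY(4)[OF z] aY(4)[OF bY[OF z]] by simp
    also have "\<dots> = orbit a z" using bij_betw_card_le_2(2)[OF O_bij(1,1) OD(1) two orb[OF z]] .
    finally show ?thesis using aY(3)[OF z] aY(3)[OF bY[OF bY[OF z]]] by auto
  qed
  \<comment> \<open>Call the parity at z odd if \<open>c z\<close> is \<open>a (b z)\<close> and
    even if it is \<open>b z\<close>. It is constant on 2-cycles, hence the same at z and at
    \<open>b (b z)\<close>, and these two contributions cancel in \<open>c (b (c z))\<close>. In
    \<open>b (c (b z))\<close> only the parity at \<open>b z\<close> enters, so the braid relation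
    makes it even.\<close>
  have eq: "c (b z) = b (b z)" if z: "z \<in> Y" for z
  proof (rule ccontr)
    assume "c (b z) \<noteq> b (b z)"
    then have 1: "c (b z) = a (b (b z))" using cb[OF bY[OF z]] by simp
    let ?w = "b (b (b z))"
    have w: "?w \<in> Y" using bY z by simp
    note zX = aY(4)[OF z] aY(4)[OF bY[OF z]] aY(4)[OF bY[OF bY[OF z]]] aY(4)[OF cY[OF z]]
    have "b (c (b z)) = a ?w" using 1 b(2) zX by simp
    moreover have "c (b (c z)) = ?w"
    proof -
      have *: "c (b (b z)) = b (b (b z)) \<and> c z = b z \<or> c (b (b z)) = a (b (b (b z))) \<and> c z = a (b z)"
        using bb[OF z]
      proof
        assume "b (b z) = z"
        then show ?thesis using cb[OF z] by auto
      next
        assume h: "b (b z) = a z"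
        have "c (a z) = a (c z)" "b (a z) = a (b z)" using c(2) b(2) zX by auto
        then show ?thesis using cb[OF z] h by auto
      qed
      then show ?thesis
      proof
        assume "c (b (b z)) = b (b (b z)) \<and> c z = b z"
        then show ?thesis by simp
      next
        assume h: "c (b (b z)) = a (b (b (b z))) \<and> c z = a (b z)"
        then have "c (b (c z)) = a (c (b (b z)))"
          using b(2) c(2) zX by auto
        then show ?thesis using h aY(2)[OF w] by simp
      qed
    qed
    ultimately show False using braid[OF zX(1)] aY(1)[OF w] by simp
  qed
  \<comment> \<open>The previous fact speaks about points \<open>b z\<close> only. As b permutes the
    2-cycles, x is such a point too, so it applies both to x and to \<open>b x\<close>.\<close>
  have "x \<in> Y" using x by (simp add: Y_def)
  then obtain P where P: "P \<in> ?O" "b ` P = orbit a x"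
    using bij_betw_imp_surj_on[OF O_bij(1)] orb by (metis imageE)
  have "x \<in> b ` P" using P self_in_orbit_bij_betw[OF a X x(1)] by simp
  then obtain y where y: "y \<in> P" "x = b y" by blast
  have "y \<in> Y" using orbits_of_sizeD[OF a X P(1)] y(1) by (auto simp: Y_def)
  then have "c x = b x" "c (b x) = b (b x)" using eq y(2) \<open>x \<in> Y\<close> by auto
  then show ?thesis by (simp add: b_def c_def)
qed

section \<open>The cycle type of the first generator\<close>

lemma braid_action_mono:
  assumes "braid_action n X s" "m \<le> n"
  shows "braid_action m X s"
  unfolding braid_action_def
proof (intro conjI allI ballI impI)
  fix i j x assume "1 \<le> i" "i + 1 < j" "j < m" "x \<in> X"
  then show "s i (s j x) = s j (s i x)" using braid_actionD(6)[OF assms(1)] assms(2) by force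
qed (use braid_actionD[OF assms(1)] assms(2) in auto)

lemma collapsed_if_first_trivial:
  assumes s: "braid_action n X s" "2 \<le> n" and triv: "moved X (s 1) = {}"
  shows "collapsed n X s"
proof -
  have 1: "(s 1 ^^ 1) x = x" if "x \<in> X" for x using triv that by (auto simp: moved_def)
  have "s j x = x" if "1 \<le> j" "j < n" "x \<in> X" for j x
    using braid_action_funpow_conj[OF s(1) _ _ that(1,2) 1 that(3)] s(2) by simp
  then show ?thesis by (simp add: collapsed_def)
qed

lemma card_moved_eq_2:
  assumes s: "braid_action n X s" "2 \<le> n" and nc: "\<not> collapsed n X s" and le: "card (moved X (s 1)) \<le> 2"
  shows "card (moved X (s 1)) = 2"
proof -
  have "finite (moved X (s 1))" using braid_actionD(1)[OF s(1)] by (simp add: moved_def)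
  moreover have "moved X (s 1) \<noteq> {}" using collapsed_if_first_trivial[OF s] nc by blast
  ultimately have "card (moved X (s 1)) \<noteq> 0" by simp
  moreover have "card (moved X (s 1)) \<noteq> 1"
    using card_moved_neq_1[OF braid_actionD(2)[OF s(1)]] s(2) by simp
  ultimately show ?thesis using le by linarith
qed

lemma card_orbit_pos:
  assumes "bij_betw a X X" "finite X" "x \<in> X"
  shows "card (orbit a x) \<noteq> 0"
  using finite_orbit[OF self_in_orbit_bij_betw[OF assms]] orbit_nonempty[of a x] by simp

lemma braid_action_tail:
  assumes s: "braid_action n X s" "3 \<le> n"
  shows "braid_action (n - 2) X (\<lambda>i. s (i + 2))"
    "\<And>i. 1 \<le> i \<Longrightarrow> i < n - 2 \<Longrightarrow> \<forall>x\<in>X. s (i + 2) (s 1 x) = s 1 (s (i + 2) x)"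
proof -
  show "braid_action (n - 2) X (\<lambda>i. s (i + 2))" using braid_action_shift[OF s(1)] .
  fix i assume "1 \<le> i" "i < n - 2"
  then have "s 1 (s (i + 2) x) = s (i + 2) (s 1 x)" if "x \<in> X" for x
    by (intro braid_actionD(6)[OF s(1)]) (use that in auto)
  then show "\<forall>x\<in>X. s (i + 2) (s 1 x) = s 1 (s (i + 2) x)" by simp
qed

text \<open>The bound 7 \<le> n provides \<open>t 1\<close>, \<open>t 3\<close> and
  \<open>t 4\<close>, that is \<open>s 3\<close>, \<open>s 5\<close> and \<open>s 6\<close>: a
  neighbouring pair and a third generator commuting with both. The induction hypothesis enters as
  the assumption \<open>IH\<close> because it is needed for sets of orbits and not for the element
  type of X.\<close>

lemma braid_action_first_large:
  assumes s: "braid_action n X s" and n: "7 \<le> n" and X: "card X \<le> n" and nc: "\<not> collapsed n X s"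
    and IH: "\<And>(Y :: 'a set set) t. braid_action (n - 2) Y t \<Longrightarrow> card Y < n - 2 \<Longrightarrow> collapsed (n - 2) Y t"
  shows "card (moved (X :: 'a set) (s 1)) = 2"
proof -
  note D = braid_actionD[OF s]
  define a where "a = s 1"
  define t where "t = (\<lambda>i. s (i + 2))"
  have a: "bij_betw a X X" using D(2)[of 1] n by (simp add: a_def)
  have t: "braid_action (n - 2) X t" and ta: "\<And>i. 1 \<le> i \<Longrightarrow> i < n - 2 \<Longrightarrow> \<forall>x\<in>X. t i (a x) = a (t i x)"
    unfolding t_def a_def using braid_action_tail[OF s] n by simp_all
  note T = braid_actionD[OF t]
  have "\<not> (\<forall>x\<in>X. t 3 (t 4 x) = t 4 (t 3 x))"
    using braid_action_collapsed[OF s, of 5] nc n by (auto simp: t_def)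
  then obtain x where x: "x \<in> X" and ne: "t 3 (t 4 x) \<noteq> t 4 (t 3 x)" by blast
  define r where "r = card (orbit a x)"
  let ?O = "orbits_of_size r a X"
  have O: "braid_action (n - 2) ?O (\<lambda>i. image (t i))" by (rule braid_action_orbits[OF t a ta])
  have P: "orbit a x \<in> ?O" using x unfolding orbits_of_size_def r_def by blast
  have large: "n - 2 \<le> card ?O"
  proof (rule ccontr)
    assume "\<not> n - 2 \<le> card ?O"
    then have "collapsed (n - 2) ?O (\<lambda>i. image (t i))" using IH[OF O] by simp
    then have eq: "t 3 ` orbit a x = t 1 ` orbit a x" "t 4 ` orbit a x = t 1 ` orbit a x"
      using P n unfolding collapsed_def by auto
    have tX: "t i \<in> X \<rightarrow> X" if "1 \<le> i" "i < n - 2" for i using T(3)[OF that] by blast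
    have i: "1 \<le> (1::nat)" "1 < n - 2" "1 \<le> (3::nat)" "3 < n - 2" "1 \<le> (4::nat)" "4 < n - 2"
      using n by simp_all
    have far: "\<forall>x\<in>X. t 3 (t 1 x) = t 1 (t 3 x)" "\<forall>x\<in>X. t 4 (t 1 x) = t 1 (t 4 x)"
      using T(6)[of 1 3] T(6)[of 1 4] n by auto
    have "t 3 x \<in> orbit a (t 1 x)"
      by (rule mem_orbit_if_image_eq[OF a D(1) tX ta tX ta x eq(1)]) (use i in simp_all)
    moreover have "t 4 x \<in> orbit a (t 1 x)"
      by (rule mem_orbit_if_image_eq[OF a D(1) tX ta tX ta x eq(2)]) (use i in simp_all)
    moreover have "a \<in> X \<rightarrow> X" using a by (auto dest: bij_betwE)
    ultimately have "t 3 (t 4 x) = t 4 (t 3 x)"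
      using commute_if_same_orbit[of a X "t 3" "t 4" "t 1" x] tX ta i far x by blast
    then show False using ne by simp
  qed
  have "r * (n - 2) \<le> n"
    using mult_le_mono2[OF large, of r] card_orbits_of_size_le[OF a D(1), of r] X by linarith
  moreover have "r \<noteq> 0" using card_orbit_pos[OF a D(1) x] by (simp add: r_def)
  moreover have "\<not> 2 \<le> r"
  proof
    assume "2 \<le> r"
    then have "2 * (n - 2) \<le> r * (n - 2)" by (rule mult_le_mono1)
    then show False using \<open>r * (n - 2) \<le> n\<close> n by linarith
  qed
  ultimately have "r = 1" by linarith
  then have "card (moved X a) \<le> 2"
    using card_moved[OF a D(1)] large X n by simp
  then show ?thesis using card_moved_eq_2[OF s _ nc] n by (simp add: a_def)
qed

lemma card_3_orbit_cube:
  assumes a: "bij_betw a X X" "finite X" "x \<in> X" and 3: "card (orbit a x) = 3"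
  shows "a (a (a x)) = x"
proof -
  let ?P = "orbit a x"
  have sub: "?P \<subseteq> X" using orbit_subset_bij_betw[OF a(1,3)] .
  have fin: "finite ?P" using sub a(2) finite_subset by blast
  have "inj_on a ?P" using bij_betw_imp_inj_on[OF a(1)] sub inj_on_subset by blast
  moreover have "a ` ?P \<subseteq> ?P" by (auto intro: orbit.intros)
  ultimately have bij: "bij_betw a ?P ?P" using endo_inj_surj[OF fin] by (simp add: bij_betw_def)
  have "a y \<noteq> y" if "y \<in> ?P" for y
  proof
    assume "a y = y"
    then have "orbit a y = {y}" by (simp add: orbit_eq_singleton_iff)
    then show False using orbit_eq_bij_betw[OF a that] 3 by simp
  qed
  then have "moved ?P a = ?P" by (auto simp: moved_def)
  then show ?thesis
    using bij_betw_moved_3_cube[OF bij] 3 self_in_orbit_bij_betw[OF a] by simp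
qed

lemma braid_action_cube:
  assumes s: "braid_action n X s" "2 \<le> n" and cube: "\<forall>x\<in>X. s 1 (s 1 (s 1 x)) = x"
    and j: "1 \<le> j" "j < n" "x \<in> X"
  shows "s j (s j (s j x)) = x"
proof -
  have "(s 1 ^^ 3) x = x" if "x \<in> X" for x using cube that by (simp add: numeral_3_eq_3)
  then have "(s j ^^ 3) x = x" using braid_action_funpow_conj[OF s(1) _ _ j(1,2), of 1 3] j s(2) by simp
  then show ?thesis by (simp add: numeral_3_eq_3)
qed

text \<open>For small \<open>n\<close> the size of the orbits of \<open>s 1\<close> on which \<open>s 3\<close> and \<open>s 4\<close> fail to commute,
  and their number, leave only a few cycle types for \<open>s 1\<close>.\<close>

lemma braid_action_first_small:
  assumes s: "braid_action n X s" and n: "n = 5 \<or> n = 6" and X: "card X \<le> n" and nc: "\<not> collapsed n X s"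
  shows "card (moved X (s 1)) = 2 \<or>
    n = 6 \<and> card X = 6 \<and> (\<forall>x\<in>X. s 1 x \<noteq> x \<and> s 1 (s 1 x) = x)"
proof -
  note D = braid_actionD[OF s]
  define a where "a = s 1"
  define t where "t = (\<lambda>i. s (i + 2))"
  define b c where "b = t 1" and "c = t 2"
  have bc: "b = s 3" "c = s 4" by (simp_all add: b_def c_def t_def eval_nat_numeral)
  have fin: "finite X" by (fact D(1))
  have a: "bij_betw a X X" using D(2)[of 1] n by (auto simp: a_def)
  have aX: "a \<in> X \<rightarrow> X" using a by (auto dest: bij_betwE)
  have t': "braid_action (n - 2) X t" and ta': "\<And>i. 1 \<le> i \<Longrightarrow> i < n - 2 \<Longrightarrow> \<forall>x\<in>X. t i (a x) = a (t i x)"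
  proof -
    have "3 \<le> n" using n by auto
    then show "braid_action (n - 2) X t" "\<And>i. 1 \<le> i \<Longrightarrow> i < n - 2 \<Longrightarrow> \<forall>x\<in>X. t i (a x) = a (t i x)"
      unfolding t_def a_def using braid_action_tail[OF s] by simp_all
  qed
  have t: "braid_action 3 X t" using braid_action_mono[OF t'] n by auto
  have ta: "\<forall>x\<in>X. t i (a x) = a (t i x)" if "1 \<le> i" "i < 3" for i
    using ta'[of i] that n by auto
  have b: "bij_betw b X X" and c: "bij_betw c X X" using D(2) n by (auto simp: bc)
  have bX: "b \<in> X \<rightarrow> X" and cX: "c \<in> X \<rightarrow> X" using b c by (auto dest: bij_betwE)
  have ba: "\<forall>x\<in>X. b (a x) = a (b x)" and ca: "\<forall>x\<in>X. c (a x) = a (c x)"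
    using ta[of 1] ta[of 2] by (auto simp: b_def c_def)
  have "\<not> (\<forall>x\<in>X. b (c x) = c (b x))"
  proof
    assume "\<forall>x\<in>X. b (c x) = c (b x)"
    then have "s 3 (s (3 + 1) x) = s (3 + 1) (s 3 x)" if "x \<in> X" for x using that by (simp add: bc)
    moreover have "1 \<le> (3::nat)" "3 + 1 < n" using n by auto
    ultimately show False using braid_action_collapsed[OF s] nc by blast
  qed
  then obtain x where x: "x \<in> X" and ne: "b (c x) \<noteq> c (b x)" by blast
  define r where "r = card (orbit a x)"
  define P where "P = orbit a x"
  define Om where "Om = orbits_of_size r a X"
  define k where "k = card Om"
  have O: "braid_action 3 Om (\<lambda>i. image (t i))" unfolding Om_def by (rule braid_action_orbits[OF t a ta])
  have O_fin: "finite Om" using braid_actionD(1)[OF O] .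
  have O_bij: "bij_betw (image b) Om Om" "bij_betw (image c) Om Om"
    using braid_actionD(2)[OF O, of 1] braid_actionD(2)[OF O, of 2] by (auto simp: b_def c_def)
  have P: "P \<in> Om" using x unfolding Om_def P_def orbits_of_size_def r_def by blast
  have O_card: "card Q = r" if "Q \<in> Om" for Q
    using orbits_of_sizeD(2)[OF a fin] that by (simp add: Om_def)
  have k0: "k \<noteq> 0" using P O_fin by (auto simp: k_def)
  have r0: "r \<noteq> 0" using card_orbit_pos[OF a fin x] by (simp add: r_def)
  have rk: "r * k \<le> card X" using card_orbits_of_size_le[OF a fin] by (simp add: k_def Om_def)
  have orb_r: "card (orbit a y) = r" if "y \<in> X" "card X = r * k" for y
  proof -
    have "card {y \<in> X. card (orbit a y) = r} = card X"
      using card_Union_orbits_of_size[OF a fin, of r] that(2)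
      by (simp add: Union_orbits_of_size[OF a fin] k_def Om_def)
    then have "{y \<in> X. card (orbit a y) = r} = X" by (intro card_subset_eq fin) auto
    then show ?thesis using that(1) by blast
  qed
  \<comment> \<open>If b and c both preserve the orbit P, they act at x as powers of a; the
    commutation argument then applies with the identity as third map.\<close>
  have not_fixed: "\<not> (b ` P = P \<and> c ` P = P)"
  proof
    assume h: "b ` P = P \<and> c ` P = P"
    have "b x \<in> orbit a (id x)"
      by (rule mem_orbit_if_image_eq[OF a fin bX ba _ _ x]) (use h in \<open>auto simp: P_def\<close>)
    moreover have "c x \<in> orbit a (id x)"
      by (rule mem_orbit_if_image_eq[OF a fin cX ca _ _ x]) (use h in \<open>auto simp: P_def\<close>)
    ultimately have "b (c x) = c (b x)"
      using commute_if_same_orbit[OF aX bX cX _ ba ca _ _ _ x, of id] by simp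
    then show False using ne by simp
  qed
  have im2: "orbit a (b (c x)) = b ` c ` P" "orbit a (c (b x)) = c ` b ` P"
    using image_orbit_commute[OF aX ba] image_orbit_commute[OF aX ca] x bX cX
    by (auto simp: P_def Pi_iff)
  have k1: "k \<noteq> 1"
  proof
    assume "k = 1"
    then have "Om = {P}" using P by (auto simp: k_def card_1_singleton_iff)
    then show False using O_bij not_fixed by (auto simp: bij_betw_def)
  qed
  have k2: "k \<noteq> 2"
  proof
    assume "k = 2"
    then have two: "card Om \<le> 2" by (simp add: k_def)
    have r2: "r * 2 \<le> card X" using rk \<open>k = 2\<close> by simp
    have "r \<le> 3" using r2 X n by linarith
    then consider "r = 1" | "r = 2" | "r = 3" using r0 by linarith
    then show False
    proof cases
      case 1
      have "b ` c ` P = c ` b ` P" using bij_betw_card_le_2(1)[OF O_bij O_fin two P] .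
      then have eq: "orbit a (b (c x)) = orbit a (c (b x))" using im2 by simp
      have "b ` c ` P \<in> Om" using bij_betw_apply[OF O_bij(1)] bij_betw_apply[OF O_bij(2)] P by blast
      then have "card (orbit a (b (c x))) = 1" using O_card 1 im2 by simp
      then obtain z where z: "orbit a (b (c x)) = {z}" by (auto simp: card_1_singleton_iff)
      have "b (c x) \<in> X" "c (b x) \<in> X" using x bX cX by auto
      then have "b (c x) \<in> {z}" "c (b x) \<in> {z}"
        using self_in_orbit_bij_betw[OF a fin] eq z by metis+
      then show False using ne by simp
    next
      case 2
      have "t 1 (t 2 x) = t 2 (t 1 x)"
        by (rule braid_action_two_2_cycles[OF t a ta _ x])
          (use two 2 in \<open>simp_all add: Om_def r_def\<close>)
      then show False using ne by (simp add: b_def c_def)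
    next
      \<comment> \<open>Two orbits of size three fill all six points, so \<open>s 1\<close> and with
        it every generator has trivial cube. A permutation of two orbits has trivial square, so b
        and c preserve both orbits.\<close>
      case 3
      then have "card X = r * k" using r2 X n \<open>k = 2\<close> by auto
      then have cube: "\<forall>x\<in>X. s 1 (s 1 (s 1 x)) = x"
        using card_3_orbit_cube[OF a fin] orb_r 3 by (simp add: a_def)
      have PX: "P \<subseteq> X" using orbit_subset_bij_betw[OF a x] by (simp add: P_def)
      have "s j ` s j ` s j ` P = P" if "1 \<le> j" "j < n" for j
      proof -
        have "s j (s j (s j y)) = y" if "y \<in> P" for y
          using braid_action_cube[OF s _ cube \<open>1 \<le> j\<close> \<open>j < n\<close>] that PX n by auto
        then show ?thesis by (auto simp: image_image)
      qed
      from this[of 3] this[of 4] have "b ` b ` b ` P = P" "c ` c ` c ` P = P"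
        unfolding bc using n by linarith+
      moreover have "b ` b ` P = P" "c ` c ` P = P"
        using bij_betw_card_le_2(2)[OF O_bij(1,1) O_fin two P] bij_betw_card_le_2(2)[OF O_bij(2,2) O_fin two P]
        by auto
      ultimately show False using not_fixed by simp
    qed
  qed
  \<comment> \<open>At least three orbits among at most six points leave r = 1 or r = 2, and for r =
    2 they fill X.\<close>
  have k3: "3 \<le> k" using k0 k1 k2 by linarith
  have "r * 3 \<le> r * k" using k3 by simp
  then have "r \<le> 2" using rk X n by linarith
  then consider "r = 1" | "r = 2" using r0 by linarith
  then show ?thesis
  proof cases
    case 2
    have "2 * k \<le> card X" using rk 2 by simp
    then have "k = 3" "card X = 6" "n = 6" using X n k3 by linarith+
    moreover from this have "card (orbit a y) = 2" if "y \<in> X" for y using orb_r[OF that] 2 by simp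
    ultimately show ?thesis using card_2_orbit(1,2)[OF a fin] unfolding a_def by blast
  next
    case 1
    have m: "card (moved X a) + k = card X" using card_moved[OF a fin] 1 by (simp add: k_def Om_def)
    \<comment> \<open>If \<open>s 1\<close> were a 3-cycle, its conjugates b and c would have
      trivial cube and would act as commuting rotations on the three fixed points of a. But x is one
      of these fixed points.\<close>
    have "card (moved X a) \<noteq> 3"
    proof
      assume three: "card (moved X a) = 3"
      then have "k = 3" using m k3 X n by linarith
      have cube: "\<forall>x\<in>X. s 1 (s 1 (s 1 x)) = x"
        using bij_betw_moved_3_cube[OF a three] by (simp add: a_def)
      define Y where "Y = X - moved X a"
      have "card Y = 3"
        using card_Union_orbits_of_size[OF a fin, of 1] \<open>k = 3\<close> 1
        unfolding Union_orbits_of_size[OF a fin] fixed_points_eq_orbits_of_size_1[OF a fin]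
        by (simp add: Y_def k_def Om_def)
      then have Yfin: "finite Y" by (simp add: card_ge_0_finite)
      have YX: "Y \<subseteq> X" by (auto simp: Y_def)
      have restr: "bij_betw g Y Y" if g: "bij_betw g X X" "\<forall>x\<in>X. g (a x) = a (g x)" for g
      proof -
        have "g ` Y \<subseteq> Y"
        proof
          fix z assume "z \<in> g ` Y"
          then obtain y where y: "y \<in> X" "a y = y" "z = g y" by (auto simp: Y_def moved_def)
          then have "a z = z" using g(2) by metis
          moreover have "z \<in> X" using bij_betw_apply[OF g(1) y(1)] y(3) by simp
          ultimately show "z \<in> Y" by (simp add: Y_def moved_def)
        qed
        moreover have "inj_on g Y" using bij_betw_imp_inj_on[OF g(1)] YX inj_on_subset by blast
        ultimately show ?thesis using endo_inj_surj[OF Yfin] by (simp add: bij_betw_def)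
      qed
      have "x \<in> {x \<in> X. card (orbit a x) = 1}" using x 1 by (simp add: r_def)
      then have "x \<in> Y" unfolding fixed_points_eq_orbits_of_size_1[OF a fin] Y_def .
      moreover have "\<forall>y\<in>Y. b (b (b y)) = y" "\<forall>y\<in>Y. c (c (c y)) = y"
        using braid_action_cube[OF s _ cube] YX n unfolding bc by auto
      ultimately have "b (c x) = c (b x)"
        using bij_betw_cube_commute[OF restr[OF b ba] restr[OF c ca] \<open>card Y = 3\<close>] by blast
      then show False using ne by simp
    qed
    then have "card (moved X a) \<le> 2" using m k3 X n by linarith
    then show ?thesis using card_moved_eq_2[OF s _ nc] n by (auto simp: a_def)
  qed
qed

text \<open>The induction descends by two, so both 5 and 6 are base cases. The element type is fixed
  to \<open>nat\<close> so that the hypothesis can be applied to numbered orbits.\<close>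

lemma braid_action_first_generator:
  fixes X :: "nat set"
  assumes "braid_action n X s" "5 \<le> n" "card X \<le> n" "\<not> collapsed n X s"
  shows "card (moved X (s 1)) = 2 \<or>
    n = 6 \<and> card X = 6 \<and> (\<forall>x\<in>X. s 1 x \<noteq> x \<and> s 1 (s 1 x) = x)"
  using assms
proof (induction n arbitrary: X s rule: less_induct)
  case (less n)
  show ?case
  proof (cases "7 \<le> n")
    case False
    then have "n = 5 \<or> n = 6" using less.prems(2) by linarith
    then show ?thesis using braid_action_first_small less.prems by blast
  next
    case True
    have "card (moved X (s 1)) = 2"
    proof (rule braid_action_first_large[OF less.prems(1) True less.prems(3,4)])
      fix Y :: "nat set set" and t
      assume "braid_action (n - 2) Y t" and Y: "card Y < n - 2"
      then obtain t' where t': "braid_action (n - 2) {..<card Y} t'"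
        and coll: "collapsed (n - 2) {..<card Y} t' \<Longrightarrow> collapsed (n - 2) Y t"
        using braid_action_transport by blast
      have "collapsed (n - 2) {..<card Y} t'"
      proof (rule ccontr)
        assume nc: "\<not> collapsed (n - 2) {..<card Y} t'"
        \<comment> \<open>The exceptional alternative needs n - 2 = 6 points and is excluded by
          \<open>card Y < n - 2\<close>. A chain of transpositions is impossible as well, since it
          occupies n - 2 distinct points.\<close>
        then have two: "card (moved {..<card Y} (t' 1)) = 2"
          using less.IH[OF _ t'] Y True by fastforce
        obtain h where h: "inj_on h {1..n - 2}" "h ` {1..n - 2} \<subseteq> {..<card Y}"
          using braid_action_transpositions[OF t' _ _ nc two] True by force
        then have "card {1..n - 2} \<le> card {..<card Y}" by (intro card_inj_on_le[of h]) auto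
        then show False using Y by simp
      qed
      then show "collapsed (n - 2) Y t" by (rule coll)
    qed
    then show ?thesis by blast
  qed
qed

text \<open>Three strands lie below the range of the induction. If \<open>s 1\<close> moved all
  three points, it would be a 3-cycle, so would its conjugate \<open>s 2\<close>, and rotations
  commute.\<close>

lemma braid_action_3_first:
  assumes s: "braid_action 3 X s" and X: "card X = 3" and nc: "\<not> collapsed 3 X s"
  shows "card (moved X (s 1)) = 2"
proof (rule card_moved_eq_2[OF s _ nc])
  note D = braid_actionD[OF s]
  have bij: "bij_betw (s 1) X X" "bij_betw (s 2) X X" using D(2) by simp_all
  have "card (moved X (s 1)) \<noteq> 3"
  proof
    assume three: "card (moved X (s 1)) = 3"
    have 1: "\<forall>x\<in>X. s 1 (s 1 (s 1 x)) = x" using bij_betw_moved_3_cube[OF bij(1) three] by blast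
    then have 2: "\<forall>x\<in>X. s 2 (s 2 (s 2 x)) = x" using braid_action_cube[OF s] by simp
    have "s 1 (s (1 + 1) x) = s (1 + 1) (s 1 x)" if "x \<in> X" for x
      using bij_betw_cube_commute[OF bij X 1 2 that] by (simp add: numeral_2_eq_2)
    then show False using braid_action_collapsed[OF s, of 1] nc by simp
  qed
  moreover have "card (moved X (s 1)) \<le> card X" using D(1) by (intro card_mono) (auto simp: moved_def)
  ultimately show "card (moved X (s 1)) \<le> 2" using X by linarith
qed simp

section \<open>Generation of the symmetric group by adjacent transpositions\<close>

lemma transpose_comp_closed:
  fixes P :: "(nat \<Rightarrow> nat) \<Rightarrow> bool"
  assumes step: "\<And>i p. 1 \<le> i \<Longrightarrow> i < n \<Longrightarrow> P p \<Longrightarrow> P (transpose i (i + 1) \<circ> p)"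
    and ab: "1 \<le> a" "a < b" "b \<le> n" and p: "P p"
  shows "P (transpose a b \<circ> p)"
  using ab p
proof (induction b arbitrary: p rule: less_induct)
  case (less b)
  show ?case
  proof (cases "b = a + 1")
    case True
    have "P (transpose a (a + 1) \<circ> p)" by (rule step) (use less.prems in auto)
    then show ?thesis using True by blast
  next
    case False
    \<comment> \<open>Conjugating (a c) by the adjacent transposition (c b) gives (a b), which
      shortens the distance by one.\<close>
    define c where "c = b - 1"
    have c: "b = c + 1" "a < c" "c < b" "1 \<le> c" "c < n" "c \<le> n" "a \<noteq> b"
      using less.prems False by (auto simp: c_def)
    have 1: "P (transpose c b \<circ> p)" using step[OF c(4,5) less.prems(4)] c(1) by blast
    have 2: "P (transpose a c \<circ> (transpose c b \<circ> p))" by (rule less.IH[OF c(3) less.prems(1) c(2,6) 1])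
    have "P (transpose c b \<circ> (transpose a c \<circ> (transpose c b \<circ> p)))"
      using step[OF c(4,5) 2] c(1) by blast
    moreover have "transpose c b \<circ> (transpose a c \<circ> (transpose c b \<circ> p)) = transpose a b \<circ> p"
      using c by (auto simp: fun_eq_iff transpose_def)
    ultimately show ?thesis by metis
  qed
qed

lemma permutes_adjacent_induct [consumes 1, case_names id adjacent]:
  fixes P :: "(nat \<Rightarrow> nat) \<Rightarrow> bool"
  assumes p: "p permutes {1..n}" and id: "P id"
    and step: "\<And>i p. 1 \<le> i \<Longrightarrow> i < n \<Longrightarrow> P p \<Longrightarrow> P (transpose i (i + 1) \<circ> p)"
  shows "P p"
  using p finite_atLeastAtMost id
proof (induction rule: permutes_induct)
  case (swap a b p)
  note closed = transpose_comp_closed[of n P, OF step _ _ _ swap.IH[OF id]]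
  show ?case
  proof (cases "a < b")
    case True
    show ?thesis by (rule closed) (use True swap.hyps in auto)
  next
    case False
    have "P (transpose b a \<circ> p)" by (rule closed) (use False swap.hyps in auto)
    then show ?thesis by (simp only: transpose_commute)
  qed
qed

section \<open>The outer automorphism of the symmetric group on six letters\<close>

text \<open>One-line notation on six letters: identities between products of explicit permutations
  become comparisons of six values.\<close>

definition perm6 :: "nat \<Rightarrow> nat \<Rightarrow> nat \<Rightarrow> nat \<Rightarrow> nat \<Rightarrow> nat \<Rightarrow> nat \<Rightarrow> nat" where
  "perm6 x1 x2 x3 x4 x5 x6 = id(1 := x1, 2 := x2, 3 := x3, 4 := x4, 5 := x5, 6 := x6)"

lemma perm6_apply [simp]:
  "perm6 x1 x2 x3 x4 x5 x6 1 = x1" "perm6 x1 x2 x3 x4 x5 x6 (Suc 0) = x1"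
  "perm6 x1 x2 x3 x4 x5 x6 2 = x2" "perm6 x1 x2 x3 x4 x5 x6 3 = x3"
  "perm6 x1 x2 x3 x4 x5 x6 4 = x4" "perm6 x1 x2 x3 x4 x5 x6 5 = x5"
  "perm6 x1 x2 x3 x4 x5 x6 6 = x6"
  by (simp_all add: perm6_def)

lemma mem_1_6: "t \<in> {1..6::nat} \<longleftrightarrow> t = 1 \<or> t = 2 \<or> t = 3 \<or> t = 4 \<or> t = 5 \<or> t = 6"
  by auto

lemma perm6_outside: "t \<notin> {1..6} \<Longrightarrow> perm6 x1 x2 x3 x4 x5 x6 t = t"
  unfolding mem_1_6 by (simp add: perm6_def)

lemma eq_perm6I:
  assumes "f 1 = x1" "f 2 = x2" "f 3 = x3" "f 4 = x4" "f 5 = x5" "f 6 = x6" "\<And>t. t \<notin> {1..6} \<Longrightarrow> f t = t"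
  shows "f = perm6 x1 x2 x3 x4 x5 x6"
proof
  fix t
  show "f t = perm6 x1 x2 x3 x4 x5 x6 t"
  proof (cases "t \<in> {1..6}")
    case True
    then show ?thesis using assms(1-6) unfolding mem_1_6 by auto
  next
    case False
    then show ?thesis using assms(7) perm6_outside by simp
  qed
qed

lemma perm6_comp:
  "perm6 x1 x2 x3 x4 x5 x6 \<circ> perm6 y1 y2 y3 y4 y5 y6 =
    (let f = perm6 x1 x2 x3 x4 x5 x6 in perm6 (f y1) (f y2) (f y3) (f y4) (f y5) (f y6))"
  unfolding Let_def by (rule eq_perm6I) (simp_all add: perm6_outside)

lemma id_perm6: "id = perm6 1 2 3 4 5 6"
  by (rule eq_perm6I) simp_all

lemma perm6_eq_iff:
  "perm6 x1 x2 x3 x4 x5 x6 = perm6 y1 y2 y3 y4 y5 y6 \<longleftrightarrow>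
    x1 = y1 \<and> x2 = y2 \<and> x3 = y3 \<and> x4 = y4 \<and> x5 = y5 \<and> x6 = y6"
  by (metis perm6_apply)

lemma transpose_perm6:
  "transpose 1 2 = perm6 2 1 3 4 5 6" "transpose 2 3 = perm6 1 3 2 4 5 6"
  "transpose 3 4 = perm6 1 2 4 3 5 6" "transpose 4 5 = perm6 1 2 3 5 4 6"
  "transpose 5 6 = perm6 1 2 3 4 6 5"
  by (rule eq_perm6I; auto simp: transpose_def)+

text \<open>The image of the transposition of \<open>a\<close> and \<open>b\<close>, for distinct \<open>a\<close> and \<open>b\<close> in \<open>{1..6}\<close>.\<close>

definition syntheme :: "nat \<Rightarrow> nat \<Rightarrow> nat \<Rightarrow> nat" where
  "syntheme a b =
    (if {a, b} = {1, 2} then perm6 2 1 4 3 6 5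
     else if {a, b} = {1, 3} then perm6 4 6 5 1 3 2
     else if {a, b} = {1, 4} then perm6 6 3 2 5 4 1
     else if {a, b} = {1, 5} then perm6 5 4 6 2 1 3
     else if {a, b} = {1, 6} then perm6 3 5 1 6 2 4
     else if {a, b} = {2, 3} then perm6 5 3 2 6 1 4
     else if {a, b} = {2, 4} then perm6 4 5 6 1 2 3
     else if {a, b} = {2, 5} then perm6 3 6 1 5 4 2
     else if {a, b} = {2, 6} then perm6 6 4 5 2 3 1
     else if {a, b} = {3, 4} then perm6 3 4 1 2 6 5
     else if {a, b} = {3, 5} then perm6 6 5 4 3 2 1
     else if {a, b} = {3, 6} then perm6 2 1 6 5 4 3
     else if {a, b} = {4, 5} then perm6 2 1 5 6 3 4
     else if {a, b} = {4, 6} then perm6 5 6 4 3 1 2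
     else if {a, b} = {5, 6} then perm6 4 3 2 1 6 5
     else id)"

text \<open>The default value \<open>id\<close> allows \<open>dual\<close> to quantify over all
  pairs of numbers: a permutation of \<open>{1..6}\<close> sends degenerate pairs to degenerate
  pairs, where the condition is trivial.\<close>

lemma syntheme_id: "a \<notin> {1..6} \<or> b \<notin> {1..6} \<or> a = b \<Longrightarrow> syntheme a b = id"
proof -
  assume ab: "a \<notin> {1..6} \<or> b \<notin> {1..6} \<or> a = b"
  have "{a, b} \<noteq> {x, y}" if "x \<in> {1..6}" "y \<in> {1..6}" "x \<noteq> y" for x y
    using ab that unfolding doubleton_eq_iff by metis
  then show ?thesis by (simp add: syntheme_def)
qed

lemma syntheme_commute: "syntheme a b = syntheme b a"
  by (simp add: syntheme_def insert_commute)

lemma syntheme_involution: "syntheme a b \<circ> syntheme a b = id"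
proof -
  have "perm6 (Suc 0) 2 3 4 5 6 = id" using id_perm6 by simp
  then show ?thesis by (simp add: syntheme_def perm6_comp Let_def)
qed

lemma syntheme_outside: "t \<notin> {1..6} \<Longrightarrow> syntheme a b t = t"
  unfolding syntheme_def by (simp add: perm6_outside del: atLeastAtMost_iff)

lemma syntheme_permutes: "syntheme a b permutes {1..6}"
proof -
  have "bij (syntheme a b)" using o_bij[OF syntheme_involution syntheme_involution] .
  then show ?thesis unfolding permutes_def bij_iff using syntheme_outside by blast
qed

text \<open>If \<open>q\<close> is the image of \<open>g\<close>, then \<open>q\<close> conjugates the images of transpositions as \<open>g\<close> conjugates
  the transpositions.\<close>

definition dual :: "(nat \<Rightarrow> nat) \<Rightarrow> (nat \<Rightarrow> nat) \<Rightarrow> bool" where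
  "dual g q \<longleftrightarrow> (\<forall>a b. q \<circ> syntheme a b = syntheme (g a) (g b) \<circ> q)"

lemma dualI:
  assumes g: "g permutes {1..6}"
    and eq: "\<And>a b. a < b \<Longrightarrow> a \<in> {1..6} \<Longrightarrow> b \<in> {1..6} \<Longrightarrow> q \<circ> syntheme a b = syntheme (g a) (g b) \<circ> q"
  shows "dual g q"
  unfolding dual_def
proof (intro allI)
  fix a b
  have in6: "g x \<in> {1..6} \<longleftrightarrow> x \<in> {1..6}" for x using permutes_in_image[OF g] by blast
  have inj: "g a = g b \<longleftrightarrow> a = b" using permutes_inj[OF g] by (simp add: inj_eq)
  consider "a \<notin> {1..6} \<or> b \<notin> {1..6} \<or> a = b" | "a < b" "a \<in> {1..6}" "b \<in> {1..6}"
    | "b < a" "a \<in> {1..6}" "b \<in> {1..6}" by linarith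
  then show "q \<circ> syntheme a b = syntheme (g a) (g b) \<circ> q"
  proof cases
    case 1
    then have "g a \<notin> {1..6} \<or> g b \<notin> {1..6} \<or> g a = g b" unfolding in6 inj .
    then show ?thesis using syntheme_id[OF 1] syntheme_id by simp
  next
    case 2
    then show ?thesis using eq by simp
  next
    case 3
    then show ?thesis using eq[of b a] syntheme_commute by metis
  qed
qed

lemma dual_comp: "dual g q \<Longrightarrow> dual g' q' \<Longrightarrow> dual (g \<circ> g') (q \<circ> q')"
  unfolding dual_def by (metis comp_apply comp_assoc)

lemma dual_perm6I:
  assumes "perm6 x1 x2 x3 x4 x5 x6 permutes {1..6}"
    and "\<forall>b\<in>{1, 2, 3, 4, 5, 6}. \<forall>a\<in>{1, 2, 3, 4, 5, 6}. a < b \<longrightarrow>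
      q \<circ> syntheme a b = syntheme (perm6 x1 x2 x3 x4 x5 x6 a) (perm6 x1 x2 x3 x4 x5 x6 b) \<circ> q"
  shows "dual (perm6 x1 x2 x3 x4 x5 x6) q"
proof (rule dualI[OF assms(1)])
  fix a b :: nat assume "a < b" and "a \<in> {1..6}" "b \<in> {1..6}"
  then have "a \<in> {1, 2, 3, 4, 5, 6}" "b \<in> {1, 2, 3, 4, 5, 6}"
    unfolding mem_1_6 by blast+
  then show "q \<circ> syntheme a b = syntheme (perm6 x1 x2 x3 x4 x5 x6 a) (perm6 x1 x2 x3 x4 x5 x6 b) \<circ> q"
    using assms(2) \<open>a < b\<close> by blast
qed

text \<open>Here the table is verified to be compatible with conjugation: fifteen identities for
  each of the five adjacent transpositions. Multiplicativity of \<open>dual\<close> extends this to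
  the whole group.\<close>

lemma dual_adjacent:
  assumes "1 \<le> i" "i < 6"
  shows "dual (transpose i (i + 1)) (syntheme i (i + 1))"
proof -
  have p: "transpose i (i + 1) permutes {1..6}" using assms by (intro permutes_swap_id) auto
  consider "i = 1" | "i = 2" | "i = 3" | "i = 4" | "i = 5" using assms by linarith
  then show ?thesis
  proof cases
    case 1
    then have t: "transpose i (i + 1) = perm6 2 1 3 4 5 6" by (simp only: one_add_one transpose_perm6)
    show ?thesis using p unfolding t
      by (rule dual_perm6I) (simp add: 1 syntheme_def doubleton_eq_iff perm6_comp Let_def)
  next
    case 2
    then have t: "transpose i (i + 1) = perm6 1 3 2 4 5 6" by (simp add: transpose_perm6)
    show ?thesis using p unfolding t
      by (rule dual_perm6I) (simp add: 2 syntheme_def doubleton_eq_iff perm6_comp Let_def)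
  next
    case 3
    then have t: "transpose i (i + 1) = perm6 1 2 4 3 5 6" by (simp add: transpose_perm6)
    show ?thesis using p unfolding t
      by (rule dual_perm6I) (simp add: 3 syntheme_def doubleton_eq_iff perm6_comp Let_def)
  next
    case 4
    then have t: "transpose i (i + 1) = perm6 1 2 3 5 4 6" by (simp add: transpose_perm6)
    show ?thesis using p unfolding t
      by (rule dual_perm6I) (simp add: 4 syntheme_def doubleton_eq_iff perm6_comp Let_def)
  next
    case 5
    then have t: "transpose i (i + 1) = perm6 1 2 3 4 6 5" by (simp add: transpose_perm6)
    show ?thesis using p unfolding t
      by (rule dual_perm6I) (simp add: 5 syntheme_def doubleton_eq_iff perm6_comp Let_def)
  qed
qed

text \<open>Commuting with a few synthemes already expresses the other values of p in terms of
  \<open>p 1\<close> in several ways, and these are consistent only for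
  \<open>p 1 = 1\<close>.\<close>

lemma dual_centralizer:
  assumes p: "p permutes {1..6}" and comm: "\<And>a b. p \<circ> syntheme a b = syntheme a b \<circ> p"
  shows "p = id"
proof -
  have c: "p (syntheme a b t) = syntheme a b (p t)" for a b t
    using fun_cong[OF comm] by simp
  \<comment> \<open>Five synthemes suffice; each contributes one equation for each of its three
    2-cycles.\<close>
  note eqs = c[of 1 2 1] c[of 1 2 3] c[of 1 2 5] c[of 1 3 1] c[of 1 3 2] c[of 1 3 3]
    c[of 2 3 1] c[of 2 3 2] c[of 2 3 4] c[of 4 5 1] c[of 4 5 3] c[of 4 5 4]
    c[of 4 6 1] c[of 4 6 2] c[of 4 6 3]
  have e: "p 2 = perm6 2 1 4 3 6 5 (p 1)" "p 4 = perm6 2 1 4 3 6 5 (p 3)" "p 6 = perm6 2 1 4 3 6 5 (p 5)"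
    "p 4 = perm6 4 6 5 1 3 2 (p 1)" "p 6 = perm6 4 6 5 1 3 2 (p 2)" "p 5 = perm6 4 6 5 1 3 2 (p 3)"
    "p 5 = perm6 5 3 2 6 1 4 (p 1)" "p 3 = perm6 5 3 2 6 1 4 (p 2)" "p 6 = perm6 5 3 2 6 1 4 (p 4)"
    "p 2 = perm6 2 1 5 6 3 4 (p 1)" "p 5 = perm6 2 1 5 6 3 4 (p 3)" "p 6 = perm6 2 1 5 6 3 4 (p 4)"
    "p 5 = perm6 5 6 4 3 1 2 (p 1)" "p 6 = perm6 5 6 4 3 1 2 (p 2)" "p 4 = perm6 5 6 4 3 1 2 (p 3)"
    using eqs by (simp_all add: syntheme_def doubleton_eq_iff)
  have "p 1 \<in> {1..6}" using permutes_in_image[OF p, of 1] by simp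
  then have "p 1 = 1" using e unfolding mem_1_6 by (elim disjE) simp_all
  then have "p = perm6 1 2 3 4 5 6"
    using e permutes_not_in[OF p] by (intro eq_perm6I) simp_all
  then show ?thesis using id_perm6 by simp
qed

text \<open>The quotient of two solutions commutes with every syntheme. Uniqueness makes the image
  of g well defined and the resulting map multiplicative.\<close>

lemma dual_unique:
  assumes q: "q permutes {1..6}" "dual g q" and q': "q' permutes {1..6}" "dual g q'"
  shows "q = q'"
proof -
  have "inv' q' \<circ> q \<circ> syntheme a b = syntheme a b \<circ> (inv' q' \<circ> q)" for a b
  proof
    fix t
    have "q (syntheme a b t) = q' (syntheme a b (inv' q' (q t)))"
      using q(2) q'(2) permutes_inverses(1)[OF q'(1)] unfolding dual_def
      by (metis comp_apply)
    then show "(inv' q' \<circ> q \<circ> syntheme a b) t = (syntheme a b \<circ> (inv' q' \<circ> q)) t"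
      using permutes_inverses(2)[OF q'(1)] by simp
  qed
  moreover have "inv' q' \<circ> q permutes {1..6}"
    using q(1) q'(1) by (simp add: permutes_compose permutes_inv)
  ultimately have "inv' q' \<circ> q = id" by (intro dual_centralizer)
  then show ?thesis
    using permutes_inv_o(1)[OF q'(1)] by (metis comp_assoc comp_id id_comp)
qed

lemma dual_id: "dual id id"
  by (simp add: dual_def)

lemma dual_exists:
  assumes "g permutes {1..6}"
  shows "\<exists>q. q permutes {1..6} \<and> dual g q"
  using assms
proof (induction rule: permutes_adjacent_induct)
  case id
  then show ?case using dual_id permutes_id by blast
next
  case (adjacent i g)
  then obtain q where "q permutes {1..6}" "dual g q" by blast
  then have "syntheme i (i + 1) \<circ> q permutes {1..6}" "dual (transpose i (i + 1) \<circ> g) (syntheme i (i + 1) \<circ> q)"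
    using permutes_compose syntheme_permutes dual_comp dual_adjacent adjacent by blast+
  then show ?case by blast
qed

text \<open>This is triviality of the kernel. The five synthemes of adjacent pairs determine their
  pairs, so h preserves \<open>{1, 2}\<close>, ..., \<open>{5, 6}\<close>; consecutive pairs share
  exactly one point, which h must fix, and then the ends are fixed too.\<close>

lemma dual_id_imp_id:
  assumes h: "h permutes {1..6}" and d: "dual h id"
  shows "h = id"
proof -
  have s: "syntheme (h a) (h b) = syntheme a b" for a b
    using d by (simp add: dual_def)
  have "{h 1, h 2} = {1, 2}" "{h 2, h 3} = {2, 3}" "{h 3, h 4} = {3, 4}" "{h 4, h 5} = {4, 5}" "{h 5, h 6} = {5, 6}"
  proof -
    have row: "syntheme 1 2 = perm6 2 1 4 3 6 5" "syntheme 2 3 = perm6 5 3 2 6 1 4" "syntheme 3 4 = perm6 3 4 1 2 6 5"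
      "syntheme 4 5 = perm6 2 1 5 6 3 4" "syntheme 5 6 = perm6 4 3 2 1 6 5"
      by (simp_all add: syntheme_def doubleton_eq_iff)
    have r: "syntheme x y = perm6 2 1 4 3 6 5 \<Longrightarrow> {x, y} = {1, 2}" "syntheme x y = perm6 5 3 2 6 1 4 \<Longrightarrow> {x, y} = {2, 3}"
      "syntheme x y = perm6 3 4 1 2 6 5 \<Longrightarrow> {x, y} = {3, 4}" "syntheme x y = perm6 2 1 5 6 3 4 \<Longrightarrow> {x, y} = {4, 5}"
      "syntheme x y = perm6 4 3 2 1 6 5 \<Longrightarrow> {x, y} = {5, 6}" for x y
      by (simp_all add: syntheme_def perm6_eq_iff id_perm6 split: if_split_asm)
    show "{h 1, h 2} = {1, 2}" by (rule r(1)) (simp only: s row)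
    show "{h 2, h 3} = {2, 3}" by (rule r(2)) (simp only: s row)
    show "{h 3, h 4} = {3, 4}" by (rule r(3)) (simp only: s row)
    show "{h 4, h 5} = {4, 5}" by (rule r(4)) (simp only: s row)
    show "{h 5, h 6} = {5, 6}" by (rule r(5)) (simp only: s row)
  qed
  then have "h 1 = 1" "h 2 = 2" "h 3 = 3" "h 4 = 4" "h 5 = 5" "h 6 = 6"
    unfolding doubleton_eq_iff by presburger+
  then have "h = perm6 1 2 3 4 5 6" using permutes_not_in[OF h] by (intro eq_perm6I)
  then show ?thesis using id_perm6 by simp
qed

section \<open>The outer automorphism and its values\<close>

definition outer6 :: "(nat \<Rightarrow> nat) \<Rightarrow> (nat \<Rightarrow> nat)" where
  "outer6 = (\<lambda>g\<in>carrier (sym_group 6). THE q. q permutes {1..6} \<and> dual g q)"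

lemma outer6:
  assumes "g permutes {1..6}"
  shows "outer6 g permutes {1..6}" "dual g (outer6 g)"
proof -
  obtain q where q: "q permutes {1..6} \<and> dual g q" using dual_exists[OF assms] by blast
  then have "(THE q. q permutes {1..6} \<and> dual g q) = q"
    using dual_unique by (intro the_equality) blast+
  then have "outer6 g = q" using assms by (simp add: outer6_def sym_group_carrier)
  then show "outer6 g permutes {1..6}" "dual g (outer6 g)" using q by auto
qed

lemma outer6_eqI:
  assumes "g permutes {1..6}" "q permutes {1..6}" "dual g q"
  shows "outer6 g = q"
  using dual_unique[OF outer6[OF assms(1)] assms(2,3)] .

lemma outer6_comp:
  assumes "g permutes {1..6}" "h permutes {1..6}"
  shows "outer6 (g \<circ> h) = outer6 g \<circ> outer6 h"
  using assms outer6 by (intro outer6_eqI permutes_compose dual_comp)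

lemma outer6_hom: "outer6 \<in> hom (sym_group 6) (sym_group 6)"
  by (intro homI) (simp_all add: sym_group_carrier sym_group_mult outer6 outer6_comp del: One_nat_def)

lemma outer6_inj: "inj_on outer6 (carrier (sym_group 6))"
proof (rule inj_onI)
  fix g h assume "g \<in> carrier (sym_group 6)" "h \<in> carrier (sym_group 6)" and eq: "outer6 g = outer6 h"
  then have g: "g permutes {1..6}" and h: "h permutes {1..6}" by (simp_all add: sym_group_carrier)
  have h': "inv' h permutes {1..6}" using permutes_inv[OF h] .
  have p: "inv' h \<circ> g permutes {1..6}" using permutes_compose[OF g h'] .
  have "outer6 (inv' h \<circ> g) = outer6 (inv' h \<circ> h)"
    using outer6_comp[OF h' g] outer6_comp[OF h' h] eq by simp
  also have "\<dots> = id" using permutes_inv_o(2)[OF h] outer6_eqI[OF permutes_id permutes_id dual_id] by simp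
  finally have "dual (inv' h \<circ> g) id" using outer6(2)[OF p] by simp
  then have "inv' h \<circ> g = id" using dual_id_imp_id[OF p] by simp
  then show "g = h" using permutes_inv_o(1)[OF h] by (metis comp_assoc comp_id id_comp)
qed

lemma outer6_auto: "outer6 \<in> auto (sym_group 6)"
proof -
  have fin: "finite (carrier (sym_group 6))"
    using finite_permutations[of "{1..6::nat}"] by (simp add: sym_group_def)
  have sub: "outer6 ` carrier (sym_group 6) \<subseteq> carrier (sym_group 6)"
    using outer6 by (auto simp: sym_group_carrier)
  \<comment> \<open>Elements of \<open>auto\<close> are extensional, which is the reason for
    restricting \<open>outer6\<close> to the carrier.\<close>
  have "outer6 \<in> extensional (carrier (sym_group 6))" by (simp add: outer6_def)
  then show ?thesis
    using outer6_hom outer6_inj endo_inj_surj[OF fin sub outer6_inj]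
    by (simp add: auto_def Bij_def bij_betw_def)
qed

text \<open>For adjacent pairs this is built in. In general a permutation g with
  \<open>g 1 = a\<close> and \<open>g 2 = b\<close> conjugates (1 2) to (a b), and by duality its
  image conjugates the corresponding synthemes.\<close>

lemma outer6_transpose:
  assumes "a \<in> {1..6}" "b \<in> {1..6}" "a \<noteq> b"
  shows "outer6 (transpose a b) = syntheme a b"
proof -
  define g where "g = transpose 1 a \<circ> transpose 2 (transpose 1 a b)"
  have "transpose 1 a b \<in> {1..6}" using assms by (auto simp: transpose_def)
  then have "transpose 2 (transpose 1 a b) permutes {1..6}" by (intro permutes_swap_id) auto
  moreover have "transpose 1 a permutes {1..6}" using assms by (intro permutes_swap_id) auto
  ultimately have g: "g permutes {1..6}" unfolding g_def by (rule permutes_compose)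
  have "transpose 1 a b \<noteq> 1" using assms(3) by (auto simp: transpose_def)
  then have g12: "g 1 = a" "g 2 = b" using assms(3) by (auto simp: g_def transpose_def)
  have t12: "transpose 1 2 permutes {1..6::nat}" by (intro permutes_swap_id) auto
  have tab: "transpose a b permutes {1..6}" using assms by (intro permutes_swap_id)
  have "transpose a b \<circ> g = g \<circ> transpose 1 2"
    using permutes_inj[OF g] by (auto simp: fun_eq_iff transpose_def inj_eq g12[symmetric])
  then have "outer6 (transpose a b) \<circ> outer6 g = outer6 g \<circ> outer6 (transpose 1 2)"
    using outer6_comp[OF tab g] outer6_comp[OF g t12] by simp
  also have "outer6 (transpose 1 2) = syntheme 1 2"
    using outer6_eqI[OF t12 syntheme_permutes[of 1 2]] dual_adjacent[of 1] by (simp add: numeral_2_eq_2)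
  also have "outer6 g \<circ> syntheme 1 2 = syntheme a b \<circ> outer6 g"
    using outer6(2)[OF g] g12 by (simp add: dual_def)
  finally show ?thesis
    using permutes_inv_o(1)[OF outer6(1)[OF g]] by (metis comp_assoc comp_id)
qed

section \<open>Fixed-point-free involutions of six points\<close>

lemma fixed_point_free_involution_4:
  assumes p: "\<forall>t\<in>{a, b, c, d}. p t \<in> {a, b, c, d} \<and> p t \<noteq> t \<and> p (p t) = t" and d: "distinct [a, b, c, d]"
  shows "p a = b \<and> p b = a \<and> p c = d \<and> p d = c \<or> p a = c \<and> p b = d \<and> p c = a \<and> p d = b \<or>
    p a = d \<and> p b = c \<and> p c = b \<and> p d = a"
proof -
  have "p a = b \<or> p a = c \<or> p a = d" using p by auto
  then show ?thesis
  proof (elim disjE)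
    assume 1: "p a = b"
    then have "p b = a" using p by auto
    then have "p c = d" using p d 1 by (metis distinct_length_2_or_more insert_iff empty_iff)
    then show ?thesis using p 1 \<open>p b = a\<close> by auto
  next
    assume 1: "p a = c"
    then have "p c = a" using p by auto
    then have "p b = d" using p d 1 by (metis distinct_length_2_or_more insert_iff empty_iff)
    then show ?thesis using p 1 \<open>p c = a\<close> by auto
  next
    assume 1: "p a = d"
    then have "p d = a" using p by auto
    then have "p b = c" using p d 1 by (metis distinct_length_2_or_more insert_iff empty_iff)
    then show ?thesis using p 1 \<open>p d = a\<close> by auto
  qed
qed

text \<open>There are five choices for the partner of 1 and three perfect matchings of the remaining
  four points; all fifteen results occur in the table. This completeness is what allows exceptional
  homomorphisms to be pulled back to transpositions.\<close>

lemma fixed_point_free_involution_6: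
  assumes p: "p permutes {1..6::nat}" and invol: "\<And>t. t \<in> {1..6} \<Longrightarrow> p t \<noteq> t \<and> p (p t) = t"
  shows "\<exists>a\<in>{1..6}. \<exists>b\<in>{1..6}. a \<noteq> b \<and> p = syntheme a b"
proof -
  have mem: "p t \<in> {1..6}" if "t \<in> {1..6}" for t using permutes_in_image[OF p] that by blast
  have rest: "\<forall>t\<in>{a, b, c, d}. p t \<in> {a, b, c, d} \<and> p t \<noteq> t \<and> p (p t) = t"
    if set: "{1..6} = {1, e, a, b, c, d}" and e: "p 1 = e" and dist: "distinct [1, e, a, b, c, d]" for a b c d e
  proof
    fix t assume t: "t \<in> {a, b, c, d}"
    then have t6: "t \<in> {1..6}" unfolding set by blast
    have e1: "p e = 1" using invol[of 1] e by simp
    have "p t \<noteq> 1" using invol[OF t6] e t dist by auto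
    moreover have "p t \<noteq> e" using invol[OF t6] e1 t dist by auto
    ultimately have "p t \<in> {a, b, c, d}" using mem[OF t6] unfolding set by blast
    then show "p t \<in> {a, b, c, d} \<and> p t \<noteq> t \<and> p (p t) = t" using invol[OF t6] by blast
  qed
  have table: "p \<in> {syntheme 1 2, syntheme 1 3, syntheme 1 4, syntheme 1 5, syntheme 1 6, syntheme 2 3, syntheme 2 4,
    syntheme 2 5, syntheme 2 6, syntheme 3 4, syntheme 3 5, syntheme 3 6, syntheme 4 5, syntheme 4 6, syntheme 5 6}"
    (is "p \<in> ?T")
  proof -
    have T: "?T = {perm6 2 1 4 3 6 5, perm6 4 6 5 1 3 2, perm6 6 3 2 5 4 1, perm6 5 4 6 2 1 3, perm6 3 5 1 6 2 4,
      perm6 5 3 2 6 1 4, perm6 4 5 6 1 2 3, perm6 3 6 1 5 4 2, perm6 6 4 5 2 3 1, perm6 3 4 1 2 6 5,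
      perm6 6 5 4 3 2 1, perm6 2 1 6 5 4 3, perm6 2 1 5 6 3 4, perm6 5 6 4 3 1 2, perm6 4 3 2 1 6 5}"
      by (simp add: syntheme_def doubleton_eq_iff)
    have p6: "p = perm6 (p 1) (p 2) (p 3) (p 4) (p 5) (p 6)"
      using permutes_not_in[OF p] by (intro eq_perm6I) simp_all
    have p11: "p (p 1) = 1" and "p 1 \<noteq> 1" using invol[of 1] by simp_all
    moreover have "p 1 = 1 \<or> p 1 = 2 \<or> p 1 = 3 \<or> p 1 = 4 \<or> p 1 = 5 \<or> p 1 = 6"
      using mem[of 1] unfolding mem_1_6 by simp
    ultimately consider "p 1 = 2" | "p 1 = 3" | "p 1 = 4" | "p 1 = 5" | "p 1 = 6" by blast
    then show ?thesis
    proof cases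
      case 1
      have "{1..6::nat} = {1, 2, 3, 4, 5, 6}" by auto
      note fixed_point_free_involution_4[OF rest[OF this 1]]
      moreover have "p 2 = 1" using p11 1 by simp
      ultimately show ?thesis using 1 unfolding T by (subst p6) (auto simp: perm6_eq_iff)
    next
      case 2
      have "{1..6::nat} = {1, 3, 2, 4, 5, 6}" by auto
      note fixed_point_free_involution_4[OF rest[OF this 2]]
      moreover have "p 3 = 1" using p11 2 by simp
      ultimately show ?thesis using 2 unfolding T by (subst p6) (auto simp: perm6_eq_iff)
    next
      case 3
      have "{1..6::nat} = {1, 4, 2, 3, 5, 6}" by auto
      note fixed_point_free_involution_4[OF rest[OF this 3]]
      moreover have "p 4 = 1" using p11 3 by simp
      ultimately show ?thesis using 3 unfolding T by (subst p6) (auto simp: perm6_eq_iff)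
    next
      case 4
      have "{1..6::nat} = {1, 5, 2, 3, 4, 6}" by auto
      note fixed_point_free_involution_4[OF rest[OF this 4]]
      moreover have "p 5 = 1" using p11 4 by simp
      ultimately show ?thesis using 4 unfolding T by (subst p6) (auto simp: perm6_eq_iff)
    next
      case 5
      have "{1..6::nat} = {1, 6, 2, 3, 4, 5}" by auto
      note fixed_point_free_involution_4[OF rest[OF this 5]]
      moreover have "p 6 = 1" using p11 5 by simp
      ultimately show ?thesis using 5 unfolding T by (subst p6) (auto simp: perm6_eq_iff)
    qed
  qed
  have ex: "\<exists>a\<in>{1..6}. \<exists>b\<in>{1..6}. a \<noteq> b \<and> p = syntheme a b"
    if "p = syntheme x y" "x \<in> {1..6}" "y \<in> {1..6}" "x \<noteq> y" for x y using that by blast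
  show ?thesis
    by ((insert table, elim insertE emptyE); (rule ex, assumption, simp, simp, simp))
qed

lemma syntheme_fixed_point_free:
  assumes "a \<in> {1..6}" "b \<in> {1..6}" "a \<noteq> b" "t \<in> {1..6}"
  shows "syntheme a b t \<noteq> t"
proof
  assume fix_t: "syntheme a b t = t"
  have "a < b \<or> b < a" using assms(3) by linarith
  moreover have "syntheme b a t = t" using fix_t by (simp only: syntheme_commute)
  moreover have "False" if "x < y" "x \<in> {1, 2, 3, 4, 5, 6}" "y \<in> {1, 2, 3, 4, 5, 6}" "syntheme x y t = t" for x y
  proof -
    have "t \<in> {1, 2, 3, 4, 5, 6}" using assms(4) unfolding mem_1_6 by blast
    moreover have "\<forall>x\<in>{1, 2, 3, 4, 5, 6}. \<forall>y\<in>{1, 2, 3, 4, 5, 6}. x < y \<longrightarrow>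
      (\<forall>t\<in>{1, 2, 3, 4, 5, 6}. syntheme x y t \<noteq> t)"
      by (simp add: syntheme_def doubleton_eq_iff)
    ultimately show False using that by blast
  qed
  moreover have "a \<in> {1, 2, 3, 4, 5, 6}" "b \<in> {1, 2, 3, 4, 5, 6}" using assms(1,2) unfolding mem_1_6 by blast+
  ultimately show False using fix_t by blast
qed

lemma outer6_cycle_2:
  "outer6 (cycle_of_list [1, 2]) = cycle_of_list [1, 2] \<circ> cycle_of_list [3, 4] \<circ> cycle_of_list [5, 6]"
proof -
  have "outer6 (transpose 1 2) = perm6 2 1 4 3 6 5"
    using outer6_transpose[of 1 2] by (simp add: syntheme_def)
  also have "\<dots> = transpose 1 2 \<circ> transpose 3 4 \<circ> transpose 5 6"
    by (simp add: transpose_perm6[simplified] transpose_perm6 perm6_comp Let_def)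
  finally show ?thesis by simp
qed

text \<open>By uniqueness it suffices to check that the prescribed image satisfies the fifteen
  conjugation identities; the cycle is never factored into transpositions.\<close>

lemma outer6_cycle_6:
  "outer6 (cycle_of_list [1, 2, 3, 4, 5, 6]) = cycle_of_list [1, 2, 3] \<circ> cycle_of_list [4, 5]"
proof -
  have c6: "cycle_of_list [1, 2, 3, 4, 5, 6] = perm6 2 3 4 5 6 1"
    by (rule eq_perm6I[symmetric, THEN sym]) (auto simp: transpose_def)
  have c: "cycle_of_list [1, 2, 3] \<circ> cycle_of_list [4, 5] = perm6 2 3 1 5 4 6"
    by (rule eq_perm6I) (auto simp: transpose_def)
  have p: "perm6 2 3 4 5 6 1 permutes {1..6}"
  proof -
    have "{1..6::nat} = set [1, 2, 3, 4, 5, 6]" by auto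
    then show ?thesis using cycle_permutes[of "[1, 2, 3, 4, 5, 6::nat]"] unfolding c6 by simp
  qed
  have q: "perm6 2 3 1 5 4 6 permutes {1..6}"
    unfolding c[symmetric]
    by (intro permutes_compose permutes_subset[OF cycle_permutes]) auto
  have "dual (perm6 2 3 4 5 6 1) (perm6 2 3 1 5 4 6)"
    by (rule dual_perm6I[OF p]) (simp add: syntheme_def doubleton_eq_iff perm6_comp Let_def)
  then show ?thesis unfolding c6 c by (rule outer6_eqI[OF p q])
qed

section \<open>Homomorphisms from the braid group\<close>

lemma hom_presented_group_class:
  assumes H: "group H" and f: "f \<in> hom (presented_group I R) H" and w: "w \<in> group_words I"
  shows "f (pres_rel I R `` {w}) = word_eval H (\<lambda>i. f (pres_rel I R `` {[(i, True)]})) w"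
proof -
  let ?G = "presented_group I R" and ?c = "\<lambda>w. pres_rel I R `` {w}"
  interpret group_hom ?G H f
    using H f presented_group_is_group by (simp add: group_hom_def group_hom_axioms_def)
  have one: "\<one>\<^bsub>?G\<^esub> = ?c []" by (simp add: presented_group_def)
  show ?thesis
    using w
  proof (induction w)
    case Nil
    then show ?case using hom_one by (simp add: one word_eval_def)
  next
    case (Cons x w)
    obtain i b where x: "x = (i, b)" by force
    have i: "i \<in> I" and w: "w \<in> group_words I" using Cons.prems by (auto simp: x group_words_def)
    have gen: "[(i, b')] \<in> group_words I" for b' using i by (simp add: group_words_def)
    have "?c [(i, False)] \<otimes>\<^bsub>?G\<^esub> ?c [(i, True)] = ?c ([(i, False)] @ [(i, True)])"
      by (rule presented_group_mult[OF gen gen])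
    also have "\<dots> = \<one>\<^bsub>?G\<^esub>"
      unfolding one using equiv_class_eq[OF equiv_pres_rel pres_cancel[OF i, of False]] by simp
    finally have "inv\<^bsub>?G\<^esub> ?c [(i, True)] = ?c [(i, False)]"
      by (intro G.inv_equality class_in_presented_group gen)
    then have letter: "f (?c [(i, b)]) = (if b then f (?c [(i, True)]) else inv\<^bsub>H\<^esub> f (?c [(i, True)]))"
      using hom_inv[OF class_in_presented_group[OF gen[of True]]] by simp
    have "f (?c (x # w)) = f (?c [(i, b)] \<otimes>\<^bsub>?G\<^esub> ?c w)"
      using presented_group_mult[OF gen w] by (simp add: x)
    also have "\<dots> = f (?c [(i, b)]) \<otimes>\<^bsub>H\<^esub> f (?c w)"
      by (intro hom_mult class_in_presented_group gen w)
    finally show ?case using Cons.IH[OF w] letter by (simp add: word_eval_def x)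
  qed
qed

lemma word_eval_cong:
  assumes "w \<in> group_words I" "\<And>i. i \<in> I \<Longrightarrow> g i = g' i"
  shows "word_eval H g w = word_eval H g' w"
  using assms(1) by (induction w) (auto simp: word_eval_def group_words_def assms(2))

lemma braid_hom_eqI:
  assumes H: "group H" and f: "f \<in> hom (braid_group n) H" and f': "f' \<in> hom (braid_group n) H"
    and eq: "\<And>i. i \<in> {1..<n} \<Longrightarrow> f (braid_gen n i) = f' (braid_gen n i)"
    and x: "x \<in> carrier (braid_group n)"
  shows "f x = f' x"
proof -
  obtain w where w: "w \<in> group_words {1..<n}" "x = pres_rel {1..<n} (braid_relations n) `` {w}"
    using x presented_group_carrierE unfolding braid_group_def by metis
  have "word_eval H (\<lambda>i. f (braid_gen n i)) w = word_eval H (\<lambda>i. f' (braid_gen n i)) w"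
    by (rule word_eval_cong[OF w(1) eq])
  then show ?thesis
    using hom_presented_group_class[OF H f[unfolded braid_group_def] w(1)]
      hom_presented_group_class[OF H f'[unfolded braid_group_def] w(1)]
    unfolding w(2) braid_gen_def by simp
qed

lemma braid_gen_closed: "i \<in> {1..<n} \<Longrightarrow> braid_gen n i \<in> carrier (braid_group n)"
  unfolding braid_gen_def braid_group_def
  by (rule class_in_presented_group) (simp add: group_words_def)

lemma braid_action_of_hom:
  assumes f: "f \<in> hom (braid_group n) (sym_group n)"
  shows "braid_action n {1..n} (\<lambda>i. f (braid_gen n i))"
  unfolding braid_action_def
proof (intro conjI allI ballI impI)
  let ?s = "\<lambda>i. f (braid_gen n i)"
  have rel: "word_eval (sym_group n) ?s u = word_eval (sym_group n) ?s v"
    if "(u, v) \<in> braid_relations n" "u \<in> group_words {1..<n}" "v \<in> group_words {1..<n}" for u v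
  proof -
    have "pres_rel {1..<n} (braid_relations n) `` {u} = pres_rel {1..<n} (braid_relations n) `` {v}"
      using equiv_class_eq[OF equiv_pres_rel pres_relation[OF that]] .
    then show ?thesis
      using hom_presented_group_class[OF sym_group_is_group f[unfolded braid_group_def]] that(2,3)
      unfolding braid_gen_def by metis
  qed
  show "bij_betw (?s i) {1..n} {1..n}" if "i \<in> {1..<n}" for i
    using hom_in_carrier[OF f braid_gen_closed[OF that]] by (simp add: sym_group_carrier permutes_imp_bij)
  show "?s i (?s (i + 1) (?s i x)) = ?s (i + 1) (?s i (?s (i + 1) x))"
    if "1 \<le> i" "i + 1 < n" for i x
  proof -
    have "([(i, True), (i + 1, True), (i, True)], [(i + 1, True), (i, True), (i + 1, True)]) \<in> braid_relations n"
      using that unfolding braid_relations_def by blast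
    from rel[OF this] show ?thesis
      using that by (simp add: group_words_def word_eval_def sym_group_mult sym_group_one fun_eq_iff)
  qed
  show "?s i (?s j x) = ?s j (?s i x)" if "1 \<le> i" "i + 1 < j" "j < n" for i j x
  proof -
    have "i \<in> {1..<n} \<and> j \<in> {1..<n} \<and> \<bar>int i - int j\<bar> > 1" using that by auto
    then have "([(i, True), (j, True)], [(j, True), (i, True)]) \<in> braid_relations n"
      unfolding braid_relations_def by blast
    from rel[OF this] show ?thesis
      using that by (simp add: group_words_def word_eval_def sym_group_mult sym_group_one fun_eq_iff)
  qed
qed simp

text \<open>If g is the common image of the generators, a word evaluates to the power of g whose
  exponent is the sum of its signs.\<close>

lemma collapsed_imp_cyclic:
  assumes n: "2 \<le> n" and f: "f \<in> hom (braid_group n) (sym_group n)"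
    and coll: "collapsed n {1..n} (\<lambda>i. f (braid_gen n i))"
  shows "\<not> noncyclic_hom (braid_group n) (sym_group n) f"
proof -
  let ?S = "sym_group n" and ?B = "braid_group n"
  interpret group_hom ?B ?S f
    using f braid_group_is_group sym_group_is_group by (simp add: group_hom_def group_hom_axioms_def)
  define g where "g = f (braid_gen n 1)"
  define K where "K = ?S\<lparr>carrier := f ` carrier ?B\<rparr>"
  have sub: "subgroup (f ` carrier ?B) ?S" by (rule img_is_subgroup)
  have K: "group K" unfolding K_def by (rule H.subgroup_imp_group[OF sub])
  have g: "g \<in> f ` carrier ?B" using braid_gen_closed[of 1 n] n by (simp add: g_def)
  have gS: "g \<in> carrier ?S" using g sub subgroup.subset by blast
  have gens: "f (braid_gen n i) = g" if "i \<in> {1..<n}" for i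
  proof
    fix x
    have p: "f (braid_gen n i) permutes {1..n}" "g permutes {1..n}"
      using hom_closed[OF braid_gen_closed[OF that]] gS by (simp_all add: sym_group_carrier)
    show "f (braid_gen n i) x = g x"
    proof (cases "x \<in> {1..n}")
      case True
      moreover have "1 \<in> {1..<n}" using n by simp
      ultimately show ?thesis using coll that unfolding collapsed_def g_def by blast
    next
      case False
      then show ?thesis using permutes_not_in[OF p(1)] permutes_not_in[OF p(2)] by simp
    qed
  qed
  have pow: "\<exists>k::int. word_eval ?S (\<lambda>i. f (braid_gen n i)) w = g [^]\<^bsub>?S\<^esub> k" if "w \<in> group_words {1..<n}" for w
    using that
  proof (induction w)
    case Nil
    show ?case by (rule exI[of _ 0]) (simp add: word_eval_def)
  next
    case (Cons y w)
    obtain i b where y: "y = (i, b)" by force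
    have i: "i \<in> {1..<n}" and w: "w \<in> group_words {1..<n}" using Cons.prems by (auto simp: y group_words_def)
    obtain k :: int where k: "word_eval ?S (\<lambda>i. f (braid_gen n i)) w = g [^]\<^bsub>?S\<^esub> k"
      using Cons.IH[OF w] by blast
    have "word_eval ?S (\<lambda>i. f (braid_gen n i)) (y # w) =
        (if b then g else inv\<^bsub>?S\<^esub> g) \<otimes>\<^bsub>?S\<^esub> g [^]\<^bsub>?S\<^esub> k"
      using k gens[OF i] by (simp add: word_eval_def y)
    also have "(if b then g else inv\<^bsub>?S\<^esub> g) = g [^]\<^bsub>?S\<^esub> (if b then 1 else - 1 :: int)"
      using gS H.int_pow_neg[OF gS, of 1] by (simp add: H.int_pow_1)
    also have "\<dots> \<otimes>\<^bsub>?S\<^esub> g [^]\<^bsub>?S\<^esub> k = g [^]\<^bsub>?S\<^esub> ((if b then 1 else - 1) + k)"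
      using H.int_pow_mult[OF gS] by simp
    finally show ?case by blast
  qed
  have gK: "g \<in> carrier K" using g by (simp add: K_def)
  have "carrier K = range (\<lambda>k::int. g [^]\<^bsub>K\<^esub> k)"
  proof
    show "carrier K \<subseteq> range (\<lambda>k::int. g [^]\<^bsub>K\<^esub> k)"
    proof
      fix y assume "y \<in> carrier K"
      then obtain x where x: "x \<in> carrier ?B" "y = f x" by (auto simp: K_def)
      then obtain w where w: "w \<in> group_words {1..<n}" "x = pres_rel {1..<n} (braid_relations n) `` {w}"
        using presented_group_carrierE unfolding braid_group_def by metis
      have "y = word_eval ?S (\<lambda>i. f (braid_gen n i)) w"
        using hom_presented_group_class[OF sym_group_is_group f[unfolded braid_group_def] w(1)] x(2) w(2)
        by (simp add: braid_gen_def)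
      then obtain k :: int where "y = g [^]\<^bsub>?S\<^esub> k" using pow[OF w(1)] by blast
      also have "\<dots> = g [^]\<^bsub>K\<^esub> k" unfolding K_def using H.int_pow_consistent[OF sub g] .
      finally show "y \<in> range (\<lambda>k::int. g [^]\<^bsub>K\<^esub> k)" by blast
    qed
    show "range (\<lambda>k::int. g [^]\<^bsub>K\<^esub> k) \<subseteq> carrier K"
      using group.int_pow_closed[OF K gK] by blast
  qed
  then have "cyclic_group K" using group.cyclic_group[OF K] gK by blast
  then show ?thesis by (simp add: noncyclic_hom_def K_def)
qed

lemma noncommuting_imp_noncyclic:
  assumes G: "group G" and H: "group H" and f: "f \<in> hom G H"
    and xy: "x \<in> carrier G" "y \<in> carrier G" "f x \<otimes>\<^bsub>H\<^esub> f y \<noteq> f y \<otimes>\<^bsub>H\<^esub> f x"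
  shows "noncyclic_hom G H f"
proof -
  interpret group_hom G H f
    using f G H by (simp add: group_hom_def group_hom_axioms_def)
  have K: "group (H\<lparr>carrier := f ` carrier G\<rparr>)" by (rule H.subgroup_imp_group[OF img_is_subgroup])
  have "\<not> cyclic_group (H\<lparr>carrier := f ` carrier G\<rparr>)"
  proof
    assume "cyclic_group (H\<lparr>carrier := f ` carrier G\<rparr>)"
    then interpret K: comm_group "H\<lparr>carrier := f ` carrier G\<rparr>"
      by (rule group.cyclic_imp_abelian_group[OF K])
    show False using K.m_comm[of "f x" "f y"] xy by simp
  qed
  then show ?thesis using f by (simp add: noncyclic_hom_def)
qed

section \<open>Conjugation to the standard projection\<close>

lemma swap_eq_transpose:
  assumes p: "p permutes X" and m: "moved X p = {a, b}"
  shows "p = transpose a b"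
proof
  fix x
  note sw = moved_pair_swap[OF permutes_imp_bij[OF p] m]
  show "p x = transpose a b x"
  proof (cases "x \<in> {a, b}")
    case True
    then show ?thesis using sw by auto
  next
    case False
    then have "p x = x" using permutes_not_in[OF p] not_moved[of x X p] m by blast
    then show ?thesis using False by (simp add: transpose_def)
  qed
qed

text \<open>The chain of points h uses all of \<open>{1..n}\<close>, so it is a relabelling v with
  \<open>s i\<close> equal to the transposition of \<open>v i\<close> and \<open>v (i + 1)\<close>;
  the inverse of v is the conjugating permutation.\<close>

lemma transpositions_conj_adjacent:
  assumes s: "braid_action n {1..n} s" and p: "\<And>i. i \<in> {1..<n} \<Longrightarrow> s i permutes {1..n}"
    and n: "3 \<le> n" "n \<noteq> 4" and nc: "\<not> collapsed n {1..n} s"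
    and two: "card (moved {1..n} (s 1)) = 2"
  obtains u where "u permutes {1..n}" "\<And>i. i \<in> {1..<n} \<Longrightarrow> u \<circ> s i \<circ> inv' u = transpose i (i + 1)"
proof -
  obtain h where h: "inj_on h {1..n}" "h ` {1..n} \<subseteq> {1..n}"
    "\<And>i. 1 \<le> i \<Longrightarrow> i < n \<Longrightarrow> moved {1..n} (s i) = {h i, h (i + 1)}"
    using braid_action_transpositions[OF s n nc two] by blast
  define v where "v x = (if x \<in> {1..n} then h x else x)" for x
  have "bij_betw h {1..n} {1..n}"
    using h(1) endo_inj_surj[OF finite_atLeastAtMost h(2,1)] unfolding bij_betw_def by blast
  then have "bij_betw v {1..n} {1..n}"
    by (rule iffD2[OF bij_betw_cong, rotated]) (simp add: v_def)
  then have v: "v permutes {1..n}" by (rule bij_imp_permutes) (auto simp: v_def)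
  have "inv' v \<circ> s i \<circ> inv' (inv' v) = transpose i (i + 1)" if i: "i \<in> {1..<n}" for i
  proof -
    have "moved {1..n} (s i) = {v i, v (i + 1)}" using h(3)[of i] i by (simp add: v_def)
    then have s: "s i = transpose (v i) (v (i + 1))" using swap_eq_transpose[OF p[OF i]] by blast
    have "s i \<circ> v = v \<circ> transpose i (i + 1)"
      unfolding s using permutes_inj[OF v] by (auto simp: fun_eq_iff transpose_def inj_eq)
    then have "inv' v \<circ> (s i \<circ> v) = (inv' v \<circ> v) \<circ> transpose i (i + 1)" by (simp only: comp_assoc)
    then show ?thesis
      using permutes_inv_o(2)[OF v] permutes_inv_inv[OF v] by (simp add: comp_assoc)
  qed
  then show thesis using that[of "inv' v"] permutes_inv[OF v] by blast
qed

lemma conj_hom: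
  assumes f: "f \<in> hom G (sym_group n)" and u: "u permutes {1..n}"
  shows "(\<lambda>x. u \<circ> f x \<circ> inv' u) \<in> hom G (sym_group n)"
proof (rule homI)
  fix x assume x: "x \<in> carrier G"
  then show "u \<circ> f x \<circ> inv' u \<in> carrier (sym_group n)"
    using hom_in_carrier[OF f x] u by (simp add: sym_group_carrier permutes_compose permutes_inv)
  fix y assume "y \<in> carrier G"
  then have "f (x \<otimes>\<^bsub>G\<^esub> y) = f x \<circ> f y" using hom_mult[OF f x] by (simp add: sym_group_mult)
  moreover have "inv' u \<circ> u = id" using permutes_inv_o(2)[OF u] .
  then have "f x \<circ> f y = f x \<circ> (inv' u \<circ> u) \<circ> f y" by simp
  ultimately show "u \<circ> f (x \<otimes>\<^bsub>G\<^esub> y) \<circ> inv' u = (u \<circ> f x \<circ> inv' u) \<otimes>\<^bsub>sym_group n\<^esub> (u \<circ> f y \<circ> inv' u)"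
    by (simp add: sym_group_mult comp_assoc)
qed

lemma conjugate_homs_sym_iff:
  "conjugate_homs G (sym_group n) f f' \<longleftrightarrow>
    (\<exists>u. u permutes {1..n} \<and> (\<forall>x\<in>carrier G. f' x = u \<circ> f x \<circ> inv' u))"
  by (auto simp: conjugate_homs_def sym_group_carrier sym_group_mult)

lemma conjugate_braid_homsI:
  assumes f: "f \<in> hom (braid_group n) (sym_group n)" and f': "f' \<in> hom (braid_group n) (sym_group n)"
    and u: "u permutes {1..n}"
    and eq: "\<And>i. i \<in> {1..<n} \<Longrightarrow> u \<circ> f (braid_gen n i) \<circ> inv' u = f' (braid_gen n i)"
  shows "conjugate_homs (braid_group n) (sym_group n) f f'"
  unfolding conjugate_homs_sym_iff
  using braid_hom_eqI[OF sym_group_is_group f' conj_hom[OF f u]] eq u by auto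

lemma braid_hom_conj_standard:
  assumes f: "f \<in> hom (braid_group n) (sym_group n)" and n: "3 \<le> n" "n \<noteq> 4"
    and nc: "\<not> collapsed n {1..n} (\<lambda>i. f (braid_gen n i))"
    and two: "card (moved {1..n} (f (braid_gen n 1))) = 2"
  shows "conjugate_homs (braid_group n) (sym_group n) f (standard_projection n)"
proof -
  have p: "f (braid_gen n i) permutes {1..n}" if "i \<in> {1..<n}" for i
    using hom_in_carrier[OF f braid_gen_closed[OF that]] by (simp add: sym_group_carrier)
  obtain u where "u permutes {1..n}"
    "\<And>i. i \<in> {1..<n} \<Longrightarrow> u \<circ> f (braid_gen n i) \<circ> inv' u = transpose i (i + 1)"
    using transpositions_conj_adjacent[OF braid_action_of_hom[OF f] p n nc two] by blast
  then show ?thesis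
    using conjugate_braid_homsI[OF f standard_projection_hom] standard_projection_gen by simp
qed

lemma noncyclic_braid_hom_conj_standard:
  assumes n: "3 \<le> n" "n \<noteq> 4" and f: "noncyclic_hom (braid_group n) (sym_group n) f"
    and exc: "\<not> (n = 6 \<and> (\<forall>x\<in>{1..n}. f (braid_gen n 1) x \<noteq> x \<and> f (braid_gen n 1) (f (braid_gen n 1) x) = x))"
  shows "conjugate_homs (braid_group n) (sym_group n) f (standard_projection n)"
proof -
  let ?s = "\<lambda>i. f (braid_gen n i)"
  have hom: "f \<in> hom (braid_group n) (sym_group n)" using f by (simp add: noncyclic_hom_def)
  have s: "braid_action n {1..n} ?s" by (rule braid_action_of_hom[OF hom])
  have nc: "\<not> collapsed n {1..n} ?s" using collapsed_imp_cyclic[OF _ hom] f n by auto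
  have "card (moved {1..n} (?s 1)) = 2"
  proof (cases "n = 3")
    case True
    then show ?thesis using braid_action_3_first[of "{1..n}" ?s] s nc by simp
  next
    case False
    then have "5 \<le> n" using n by linarith
    then show ?thesis using braid_action_first_generator[OF s] nc exc by auto
  qed
  then show ?thesis by (rule braid_hom_conj_standard[OF hom n nc])
qed

section \<open>Homomorphisms out of the symmetric group\<close>

lemma sym_group_hom_eqI:
  assumes f: "f \<in> hom (sym_group n) H" and f': "f' \<in> hom (sym_group n) H" and H: "group H"
    and eq: "\<And>i. 1 \<le> i \<Longrightarrow> i < n \<Longrightarrow> f (transpose i (i + 1)) = f' (transpose i (i + 1))"
    and p: "p \<in> carrier (sym_group n)"
  shows "f p = f' p"
proof -
  have "p permutes {1..n}" using p by (simp add: sym_group_carrier)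
  \<comment> \<open>Membership is carried through the induction because multiplicativity is
    available only on the carrier.\<close>
  then have "p permutes {1..n} \<and> f p = f' p"
  proof (induction rule: permutes_adjacent_induct)
    case id
    show ?case
      using hom_one[OF f sym_group_is_group H] hom_one[OF f' sym_group_is_group H] permutes_id
      unfolding sym_group_one by metis
  next
    case (adjacent i p)
    have t: "transpose i (i + 1) permutes {1..n}" using adjacent by (intro permutes_swap_id) auto
    then have c: "transpose i (i + 1) \<in> carrier (sym_group n)" "p \<in> carrier (sym_group n)"
      using adjacent by (simp_all add: sym_group_carrier)
    have "f (transpose i (i + 1) \<circ> p) = f' (transpose i (i + 1) \<circ> p)"
      using hom_mult[OF f c] hom_mult[OF f' c] eq[OF adjacent(1,2)] adjacent(3)
      by (simp add: sym_group_mult)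
    then show ?case using permutes_compose[OF _ t] adjacent(3) by blast
  qed
  then show ?thesis by blast
qed

text \<open>The projection takes the braid generators to the adjacent transpositions, and a
  homomorphism from the symmetric group is determined by its values there.\<close>

lemma conjugate_sym_homsI:
  assumes f: "f \<in> hom (sym_group n) (sym_group n)" and f': "f' \<in> hom (sym_group n) (sym_group n)"
    and conj: "conjugate_homs (braid_group n) (sym_group n) (f \<circ> standard_projection n) (f' \<circ> standard_projection n)"
  shows "conjugate_homs (sym_group n) (sym_group n) f f'"
proof -
  obtain u where u: "u permutes {1..n}"
    "\<forall>x\<in>carrier (braid_group n). f' (standard_projection n x) = u \<circ> f (standard_projection n x) \<circ> inv' u"
    using conj unfolding conjugate_homs_sym_iff by auto
  have "f' p = u \<circ> f p \<circ> inv' u" if "p \<in> carrier (sym_group n)" for p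
  proof (rule sym_group_hom_eqI[OF f' conj_hom[OF f u(1)] sym_group_is_group _ that])
    fix i assume i: "1 \<le> i" "i < n"
    then have "i \<in> {1..<n}" by simp
    then show "f' (transpose i (i + 1)) = u \<circ> f (transpose i (i + 1)) \<circ> inv' u"
      using u(2) braid_gen_closed[of i n] standard_projection_gen[of i n] by metis
  qed
  then show ?thesis using u(1) unfolding conjugate_homs_sym_iff by blast
qed

lemma conjugate_homs_sym:
  assumes "conjugate_homs G (sym_group n) f f'"
  shows "conjugate_homs G (sym_group n) f' f"
proof -
  obtain u where u: "u permutes {1..n}" "\<forall>x\<in>carrier G. f' x = u \<circ> f x \<circ> inv' u"
    using assms unfolding conjugate_homs_sym_iff by blast
  have "f x = inv' u \<circ> f' x \<circ> inv' (inv' u)" if "x \<in> carrier G" for x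
  proof -
    have "inv' u \<circ> f' x \<circ> inv' (inv' u) = (inv' u \<circ> u) \<circ> f x \<circ> (inv' u \<circ> u)"
      using u that permutes_inv_inv[OF u(1)] by (simp only: comp_assoc)
    then show ?thesis using permutes_inv_o(2)[OF u(1)] by simp
  qed
  then show ?thesis using permutes_inv[OF u(1)] unfolding conjugate_homs_sym_iff by blast
qed

lemma autoD:
  assumes "\<psi> \<in> auto G"
  shows "\<psi> \<in> hom G G" "inj_on \<psi> (carrier G)"
  using assms by (auto simp: auto_def Bij_def bij_betw_def)

text \<open>The transpositions (1 2) and (2 3) do not commute, and injectivity of the automorphism
  preserves this, whereas a cyclic image would be abelian.\<close>

lemma noncyclic_comp_standard_projection:
  assumes \<psi>: "\<psi> \<in> auto (sym_group n)" and n: "3 \<le> n"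
  shows "noncyclic_hom (braid_group n) (sym_group n) (\<psi> \<circ> standard_projection n)"
proof (rule noncommuting_imp_noncyclic[OF braid_group_is_group sym_group_is_group])
  note hom = autoD(1)[OF \<psi>]
  show "\<psi> \<circ> standard_projection n \<in> hom (braid_group n) (sym_group n)"
    by (rule hom_compose[OF standard_projection_hom hom])
  have gens: "1 \<in> {1..<n}" "2 \<in> {1..<n}" using n by auto
  show "braid_gen n 1 \<in> carrier (braid_group n)" "braid_gen n 2 \<in> carrier (braid_group n)"
    using gens braid_gen_closed by blast+
  let ?a = "transpose 1 2 :: nat \<Rightarrow> nat" and ?b = "transpose 2 3 :: nat \<Rightarrow> nat"
  have ab: "?a \<in> carrier (sym_group n)" "?b \<in> carrier (sym_group n)"
    unfolding sym_group_carrier using n by (auto intro!: permutes_swap_id)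
  have closed: "?a \<circ> ?b \<in> carrier (sym_group n)" "?b \<circ> ?a \<in> carrier (sym_group n)"
    using ab by (simp_all add: sym_group_carrier permutes_compose)
  have "(?a \<circ> ?b) 1 \<noteq> (?b \<circ> ?a) 1" by (simp add: transpose_def)
  then have "?a \<circ> ?b \<noteq> ?b \<circ> ?a" by metis
  then have "\<psi> (?a \<circ> ?b) \<noteq> \<psi> (?b \<circ> ?a)"
    using autoD(2)[OF \<psi>] closed by (simp add: inj_on_eq_iff)
  moreover have "standard_projection n (braid_gen n 1) = ?a" "standard_projection n (braid_gen n 2) = ?b"
    using standard_projection_gen[OF gens(1)] standard_projection_gen[OF gens(2)]
    by (simp_all add: numeral_2_eq_2 numeral_3_eq_3)
  ultimately show "(\<psi> \<circ> standard_projection n) (braid_gen n 1) \<otimes>\<^bsub>sym_group n\<^esub> (\<psi> \<circ> standard_projection n) (braid_gen n 2) \<noteq>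
      (\<psi> \<circ> standard_projection n) (braid_gen n 2) \<otimes>\<^bsub>sym_group n\<^esub> (\<psi> \<circ> standard_projection n) (braid_gen n 1)"
    using hom_mult[OF hom ab] hom_mult[OF hom ab(2,1)] by (simp add: sym_group_mult)
qed

section \<open>The exceptional homomorphisms on six strands\<close>

lemma syntheme_not_conj_transpose:
  assumes "a \<in> {1..6}" "b \<in> {1..6}" "a \<noteq> b" and u: "u permutes {1..6}"
  shows "u \<circ> syntheme a b \<circ> inv' u \<noteq> transpose 1 2"
proof
  assume eq: "u \<circ> syntheme a b \<circ> inv' u = transpose 1 2"
  \<comment> \<open>The transposition (1 2) fixes 3, so the syntheme would fix the preimage of 3
    under u.\<close>
  have "u (syntheme a b (inv' u 3)) = 3" using fun_cong[OF eq, of 3] by (simp add: transpose_def)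
  then have "syntheme a b (inv' u 3) = inv' u 3" using permutes_inverses[OF u] by metis
  moreover have "inv' u 3 \<in> {1..6}" using permutes_in_image[OF permutes_inv[OF u], of 3] by simp
  ultimately show False using syntheme_fixed_point_free[OF assms(1-3)] by blast
qed

lemma outer6_transpose_12: "outer6 (transpose 1 2) = syntheme 1 2"
  by (rule outer6_transpose) auto

lemma outer_automorphism_outer6: "outer_automorphism (sym_group 6) outer6"
  unfolding outer_automorphism_def
proof (intro conjI notI)
  show "outer6 \<in> auto (sym_group 6)" by (rule outer6_auto)
  assume "\<exists>s\<in>carrier (sym_group 6). \<forall>x\<in>carrier (sym_group 6).
    outer6 x = s \<otimes>\<^bsub>sym_group 6\<^esub> x \<otimes>\<^bsub>sym_group 6\<^esub> inv\<^bsub>sym_group 6\<^esub> s"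
  then have "conjugate_homs (sym_group 6) (sym_group 6) (\<lambda>x. x) outer6"
    by (simp add: conjugate_homs_def)
  then have "conjugate_homs (sym_group 6) (sym_group 6) outer6 (\<lambda>x. x)" by (rule conjugate_homs_sym)
  then obtain u where u: "u permutes {1..6}" "\<forall>x\<in>carrier (sym_group 6). x = u \<circ> outer6 x \<circ> inv' u"
    unfolding conjugate_homs_sym_iff by blast
  have "transpose 1 2 \<in> carrier (sym_group 6)"
    unfolding sym_group_carrier by (intro permutes_swap_id) auto
  then have "u \<circ> syntheme 1 2 \<circ> inv' u = transpose 1 2" using u(2) outer6_transpose_12 by metis
  then show False using syntheme_not_conj_transpose[OF _ _ _ u(1), of 1 2] by simp
qed

lemma outer6_comp_projection_not_standard:
  "\<not> conjugate_homs (braid_group 6) (sym_group 6) (outer6 \<circ> standard_projection 6) (standard_projection 6)"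
proof
  assume "conjugate_homs (braid_group 6) (sym_group 6) (outer6 \<circ> standard_projection 6) (standard_projection 6)"
  then obtain u where u: "u permutes {1..6}"
    "\<forall>x\<in>carrier (braid_group 6). standard_projection 6 x = u \<circ> outer6 (standard_projection 6 x) \<circ> inv' u"
    unfolding conjugate_homs_sym_iff by auto
  have 1: "1 \<in> {1..<6::nat}" by simp
  have "standard_projection 6 (braid_gen 6 1) = transpose 1 2"
    using standard_projection_gen[OF 1] by (simp add: numeral_2_eq_2)
  then have "u \<circ> syntheme 1 2 \<circ> inv' u = transpose 1 2"
    using u(2) braid_gen_closed[OF 1] outer6_transpose_12 by metis
  then show False using syntheme_not_conj_transpose[OF _ _ _ u(1), of 1 2] by simp
qed

lemma comp_permutes_cancel:
  assumes "r permutes S" "p \<circ> r = q \<circ> r"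
  shows "p = q"
proof -
  have "p \<circ> (r \<circ> inv' r) = q \<circ> (r \<circ> inv' r)"
    unfolding comp_assoc[symmetric] assms(2) by (rule refl)
  then show ?thesis unfolding permutes_inv_o(1)[OF assms(1)] comp_id .
qed

lemma permutes_eq_onI:
  assumes "p permutes X" "q permutes X" "\<And>x. x \<in> X \<Longrightarrow> p x = q x"
  shows "p = q"
  using assms by (metis ext permutes_not_in)

text \<open>A fixed-point-free involution is the image of a transposition under the outer automorphism, so
  that the exceptional case can be pulled back to the case of transpositions.\<close>

lemma exceptional_braid_hom_conj:
  assumes f: "noncyclic_hom (braid_group 6) (sym_group 6) f"
    and nst: "\<not> conjugate_homs (braid_group 6) (sym_group 6) f (standard_projection 6)"
  shows "conjugate_homs (braid_group 6) (sym_group 6) f (outer6 \<circ> standard_projection 6)"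
proof -
  define s where "s i = f (braid_gen 6 i)" for i
  have hom: "f \<in> hom (braid_group 6) (sym_group 6)" using f by (simp add: noncyclic_hom_def)
  have act: "braid_action 6 {1..6} s"
    using braid_action_of_hom[OF hom] by (simp add: s_def[abs_def])
  have nc: "\<not> collapsed 6 {1..6} s"
    using collapsed_imp_cyclic[OF _ hom] f by (auto simp: s_def[abs_def])
  have s: "s i permutes {1..6}" if "i \<in> {1..<6}" for i
    using hom_in_carrier[OF hom braid_gen_closed[OF that]] by (simp add: sym_group_carrier s_def)
  have first: "\<forall>x\<in>{1..6}. s 1 x \<noteq> x \<and> s 1 (s 1 x) = x"
  proof -
    have "3 \<le> (6::nat)" "6 \<noteq> (4::nat)" by simp_all
    then show ?thesis using noncyclic_braid_hom_conj_standard[OF _ _ f] nst unfolding s_def by blast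
  qed
  have "\<exists>a\<in>{1..6}. \<exists>b\<in>{1..6}. a \<noteq> b \<and> s i = syntheme a b" if i: "i \<in> {1..<6}" for i
  proof (rule fixed_point_free_involution_6[OF s[OF i]])
    fix x assume x: "x \<in> {1..6::nat}"
    have i': "1 \<le> i" "i < 6" using i by auto
    \<comment> \<open>All generators are conjugate: the trivial square passes from
      \<open>s 1\<close> to \<open>s i\<close> directly, and freeness from fixed points passes
      through the number of moved points.\<close>
    have "(s 1 ^^ 2) y = y" if "y \<in> {1..6}" for y using first that by (simp add: numeral_2_eq_2)
    then have "(s i ^^ 2) x = x" using braid_action_funpow_conj[OF act _ _ i', of 1 2] x by simp
    then have 2: "s i (s i x) = x" by (simp add: numeral_2_eq_2)
    have "moved {1..6} (s 1) = {1..6}" using first by (auto simp: moved_def)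
    then have "card (moved {1..6} (s i)) = card {1..6::nat}"
      using card_moved_conj[OF act i', of 1] by simp
    then have "moved {1..6} (s i) = {1..6}" by (intro card_subset_eq) (auto simp: moved_def)
    then show "s i x \<noteq> x \<and> s i (s i x) = x" using 2 x unfolding moved_def by blast
  qed
  then obtain a b where ab: "\<And>i. i \<in> {1..<6} \<Longrightarrow> a i \<in> {1..6} \<and> b i \<in> {1..6} \<and> a i \<noteq> b i \<and> s i = syntheme (a i) (b i)"
    by metis
  define t where "t i = transpose (a i) (b i)" for i
  have t: "t i permutes {1..6}" "outer6 (t i) = s i" if "i \<in> {1..<6}" for i
    using ab[OF that] outer6_transpose[of "a i" "b i"] permutes_swap_id[of "a i" "{1..6}" "b i"]
    by (auto simp: t_def)
  have outer6_eq: "p = q" if "p permutes {1..6}" "q permutes {1..6}" "outer6 p = outer6 q" for p q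
    using outer6_inj that by (simp add: inj_on_eq_iff sym_group_carrier)
  \<comment> \<open>The relations hold for the \<open>s i\<close>, which are the images of the
    \<open>t i\<close>; injectivity of \<open>outer6\<close> lifts them.\<close>
  have t_act: "braid_action 6 {1..6} t"
    unfolding braid_action_def
  proof (intro conjI allI ballI impI)
    show "bij_betw (t i) {1..6} {1..6}" if "i \<in> {1..<6}" for i
      using permutes_imp_bij[OF t(1)[OF that]] .
    show "t i (t (i + 1) (t i x)) = t (i + 1) (t i (t (i + 1) x))" if "1 \<le> i" "i + 1 < 6" for i x
    proof -
      have i: "i \<in> {1..<6}" "i + 1 \<in> {1..<6}" using that by auto
      note p = t(1)[OF i(1)] t(1)[OF i(2)]
      note sp = s[OF i(1)] s[OF i(2)]
      have "s i \<circ> (s (i + 1) \<circ> s i) = s (i + 1) \<circ> (s i \<circ> s (i + 1))"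
      proof (rule permutes_eq_onI[of _ "{1..6}"])
        fix x :: nat assume "x \<in> {1..6}"
        then show "(s i \<circ> (s (i + 1) \<circ> s i)) x = (s (i + 1) \<circ> (s i \<circ> s (i + 1))) x"
          unfolding comp_apply by (rule braid_actionD(5)[OF act that])
      qed (intro permutes_compose sp)+
      then have "outer6 (t i \<circ> (t (i + 1) \<circ> t i)) = outer6 (t (i + 1) \<circ> (t i \<circ> t (i + 1)))"
        using outer6_comp[OF p] outer6_comp[OF p(2,1)] outer6_comp[OF p(1) permutes_compose[OF p]]
          outer6_comp[OF p(2) permutes_compose[OF p(2,1)]] t(2)[OF i(1)] t(2)[OF i(2)]
        by (simp only:)
      then have "t i \<circ> (t (i + 1) \<circ> t i) = t (i + 1) \<circ> (t i \<circ> t (i + 1))"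
        by (rule outer6_eq[rotated 2]) (intro permutes_compose p)+
      from fun_cong[OF this, of x] show ?thesis by simp
    qed
    show "t i (t j x) = t j (t i x)" if "1 \<le> i" "i + 1 < j" "j < 6" for i j x
    proof -
      have i: "i \<in> {1..<6}" "j \<in> {1..<6}" using that by auto
      note p = t(1)[OF i(1)] t(1)[OF i(2)]
      note sp = s[OF i(1)] s[OF i(2)]
      have "s i \<circ> s j = s j \<circ> s i"
      proof (rule permutes_eq_onI[of _ "{1..6}"])
        fix x :: nat assume "x \<in> {1..6}"
        then show "(s i \<circ> s j) x = (s j \<circ> s i) x"
          unfolding comp_apply by (rule braid_actionD(6)[OF act that])
      qed (intro permutes_compose sp)+
      then have "outer6 (t i \<circ> t j) = outer6 (t j \<circ> t i)"
        using outer6_comp[OF p] outer6_comp[OF p(2,1)] t(2)[OF i(1)] t(2)[OF i(2)] by (simp only:)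
      then have "t i \<circ> t j = t j \<circ> t i"
        by (rule outer6_eq[rotated 2]) (intro permutes_compose p)+
      from fun_cong[OF this, of x] show ?thesis by simp
    qed
  qed simp
  have t_nc: "\<not> collapsed 6 {1..6} t"
  proof
    assume coll: "collapsed 6 {1..6} t"
    have "collapsed 6 {1..6} s"
      unfolding collapsed_def
    proof (intro ballI)
      fix i j x assume ij: "i \<in> {1..<6::nat}" "j \<in> {1..<6::nat}"
      have "t i = t j"
        by (rule permutes_eq_onI[OF t(1)[OF ij(1)] t(1)[OF ij(2)]])
          (use coll ij in \<open>unfold collapsed_def, blast\<close>)
      then show "s i x = s j x" using t(2)[OF ij(1)] t(2)[OF ij(2)] by metis
    qed
    then show False using nc by blast
  qed
  have "moved {1..6} (t 1) = {a 1, b 1}" "a 1 \<noteq> b 1"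
    using ab[of 1] by (auto simp: t_def moved_def transpose_def)
  then have two: "card (moved {1..6} (t 1)) = 2" by simp
  obtain u where u: "u permutes {1..6}" "\<And>i. i \<in> {1..<6} \<Longrightarrow> u \<circ> t i \<circ> inv' u = transpose i (i + 1)"
    using transpositions_conj_adjacent[OF t_act t(1) _ _ t_nc two] by auto
  have u': "inv' u permutes {1..6}" using permutes_inv[OF u(1)] .
  have "outer6 u \<circ> outer6 (inv' u) = outer6 (u \<circ> inv' u)" using outer6_comp[OF u(1) u'] by simp
  also have "\<dots> = id"
    using permutes_inv_o(1)[OF u(1)] outer6_eqI[OF permutes_id permutes_id dual_id] by simp
  finally have "inv' (outer6 u) \<circ> (outer6 u \<circ> outer6 (inv' u)) = inv' (outer6 u)" by simp
  then have outer6_inv: "outer6 (inv' u) = inv' (outer6 u)"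
    using permutes_inv_o(2)[OF outer6(1)[OF u(1)]] by (simp flip: comp_assoc)
  show ?thesis
  proof (rule conjugate_braid_homsI[OF hom _ outer6(1)[OF u(1)]])
    show "outer6 \<circ> standard_projection 6 \<in> hom (braid_group 6) (sym_group 6)"
      by (rule hom_compose[OF standard_projection_hom outer6_hom])
    fix i :: nat assume i: "i \<in> {1..<6}"
    \<comment> \<open>Applying \<open>outer6\<close> to the conjugation of \<open>t i\<close> by u
      turns it into the conjugation of \<open>s i\<close> by \<open>outer6 u\<close>.\<close>
    have "outer6 u \<circ> s i \<circ> inv' (outer6 u) = outer6 (u \<circ> t i \<circ> inv' u)"
      using t[OF i] u(1) u' by (simp add: outer6_comp permutes_compose outer6_inv del: One_nat_def)
    then show "outer6 u \<circ> f (braid_gen 6 i) \<circ> inv' (outer6 u) = (outer6 \<circ> standard_projection 6) (braid_gen 6 i)"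
      using u(2)[OF i] standard_projection_gen[OF i] by (simp add: s_def)
  qed
qed

text \<open>Composing with the projection turns \<psi> into a non-cyclic homomorphism from the braid
  group. If it were conjugate to the projection, \<psi> would be inner; so it is exceptional, and
  the classification of exceptional homomorphisms descends to the symmetric group.\<close>

lemma outer_automorphism_conj_outer6:
  assumes \<psi>: "outer_automorphism (sym_group 6) \<psi>"
  shows "conjugate_homs (sym_group 6) (sym_group 6) \<psi> outer6"
proof -
  have aut: "\<psi> \<in> auto (sym_group 6)" using \<psi> by (simp add: outer_automorphism_def)
  note hom = autoD(1)[OF aut]
  have id_hom: "(\<lambda>x. x) \<in> hom (sym_group 6) (sym_group 6)" by (simp add: hom_def)
  have nc: "noncyclic_hom (braid_group 6) (sym_group 6) (\<psi> \<circ> standard_projection 6)"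
    by (rule noncyclic_comp_standard_projection[OF aut]) simp
  have "\<not> conjugate_homs (braid_group 6) (sym_group 6) (\<psi> \<circ> standard_projection 6) (standard_projection 6)"
  proof
    assume "conjugate_homs (braid_group 6) (sym_group 6) (\<psi> \<circ> standard_projection 6) (standard_projection 6)"
    then have "conjugate_homs (sym_group 6) (sym_group 6) \<psi> (\<lambda>x. x)"
      by (intro conjugate_sym_homsI[OF hom id_hom]) (simp add: comp_def)
    then have "conjugate_homs (sym_group 6) (sym_group 6) (\<lambda>x. x) \<psi>" by (rule conjugate_homs_sym)
    then show False using \<psi> by (simp add: outer_automorphism_def conjugate_homs_def)
  qed
  then show ?thesis
    using exceptional_braid_hom_conj[OF nc] conjugate_sym_homsI[OF hom outer6_hom] by blast
qed

text \<open>Conjugation by the 6-cycle moves each adjacent transposition to the next one, so the two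
  given values determine the automorphism on generators. Outside the carrier, extensionality forces
  equality.\<close>

lemma auto_eq_outer6I:
  assumes \<psi>: "\<psi> \<in> auto (sym_group 6)"
    and t: "\<psi> (cycle_of_list [1, 2]) = outer6 (cycle_of_list [1, 2])"
    and c: "\<psi> (cycle_of_list [1, 2, 3, 4, 5, 6]) = outer6 (cycle_of_list [1, 2, 3, 4, 5, 6])"
  shows "\<psi> = outer6"
proof
  fix p
  let ?S = "sym_group 6" and ?c = "cycle_of_list [1, 2, 3, 4, 5, 6 :: nat]"
  note hom = autoD(1)[OF \<psi>]
  have "{1..6::nat} = set [1, 2, 3, 4, 5, 6]" by auto
  then have "?c permutes {1..6}" using cycle_permutes[of "[1, 2, 3, 4, 5, 6::nat]"] by (simp only:)
  then have cS: "?c \<in> carrier ?S" by (simp add: sym_group_carrier)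
  have c_apply: "?c x = (if x = 6 then 1 else if 1 \<le> x \<and> x < 6 then x + 1 else x)" for x
    by (auto simp: transpose_def)
  have inj: "?c x = ?c y \<longleftrightarrow> x = y" for x y
    using permutes_inj[OF \<open>?c permutes {1..6}\<close>] by (simp only: inj_eq)
  have tS: "transpose i (i + 1) \<in> carrier ?S" if "1 \<le> i" "i < 6" for i :: nat
    unfolding sym_group_carrier using that by (intro permutes_swap_id) auto
  have gens: "\<psi> (transpose i (i + 1)) = outer6 (transpose i (i + 1))" if "1 \<le> i" "i < 6" for i
    using that
  proof (induction i rule: nat_induct_at_least)
    case base
    show ?case using t by (simp add: numeral_2_eq_2)
  next
    case (Suc i)
    have i: "1 \<le> i" "i < 6" "1 \<le> Suc i" "Suc i < 6" using Suc by simp_all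
    have ci: "?c i = Suc i" "?c (i + 1) = Suc i + 1" using i unfolding c_apply by simp_all
    have eq: "transpose (Suc i) (Suc i + 1) \<circ> ?c = ?c \<circ> transpose i (i + 1)"
    proof
      fix x
      have "?c x = Suc i \<longleftrightarrow> x = i" "?c x = Suc i + 1 \<longleftrightarrow> x = i + 1" using inj[of x i] inj[of x "i + 1"] ci by simp_all
      then show "(transpose (Suc i) (Suc i + 1) \<circ> ?c) x = (?c \<circ> transpose i (i + 1)) x"
        using ci unfolding comp_def transpose_def by presburger
    qed
    have image: "g (transpose (Suc i) (Suc i + 1)) \<circ> g ?c = g ?c \<circ> g (transpose i (i + 1))"
      if g: "g \<in> hom ?S ?S" for g
      using hom_mult[OF g tS[OF i(3,4)] cS] hom_mult[OF g cS tS[OF i(1,2)]] eq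
      by (simp add: sym_group_mult del: cycle_of_list.simps)
    have "\<psi> (transpose (Suc i) (Suc i + 1)) \<circ> \<psi> ?c = outer6 (transpose (Suc i) (Suc i + 1)) \<circ> \<psi> ?c"
      using image[OF hom] image[OF outer6_hom] c Suc.IH i(2) by metis
    moreover have "\<psi> ?c permutes {1..6}" using hom_in_carrier[OF hom cS] unfolding sym_group_carrier .
    ultimately show ?case by (rule comp_permutes_cancel[rotated])
  qed
  show "\<psi> p = outer6 p"
  proof (cases "p \<in> carrier ?S")
    case True
    show ?thesis by (rule sym_group_hom_eqI[OF hom outer6_hom sym_group_is_group gens True])
  next
    case False
    moreover have "\<psi> \<in> extensional (carrier ?S)" using \<psi> by (simp add: auto_def Bij_def)
    ultimately show ?thesis by (simp add: extensional_def outer6_def)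
  qed
qed

theorem corollary2:
  shows "(\<forall>n f. 3 \<le> n \<longrightarrow> n \<noteq> 4 \<longrightarrow> n \<noteq> 6 \<longrightarrow>
      noncyclic_hom (braid_group n) (sym_group n) f \<longrightarrow>
      conjugate_homs (braid_group n) (sym_group n) f (standard_projection n)) \<and>
    (\<exists>\<phi>. outer_automorphism (sym_group 6) \<phi> \<and>
      \<phi> (cycle_of_list [1, 2])
        = cycle_of_list [1, 2] \<circ> cycle_of_list [3, 4] \<circ> cycle_of_list [5, 6] \<and>
      \<phi> (cycle_of_list [1, 2, 3, 4, 5, 6]) = cycle_of_list [1, 2, 3] \<circ> cycle_of_list [4, 5] \<and>
      (\<forall>\<psi>\<in>auto (sym_group 6).
        \<psi> (cycle_of_list [1, 2])
          = cycle_of_list [1, 2] \<circ> cycle_of_list [3, 4] \<circ> cycle_of_list [5, 6] \<and>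
        \<psi> (cycle_of_list [1, 2, 3, 4, 5, 6]) = cycle_of_list [1, 2, 3] \<circ> cycle_of_list [4, 5]
        \<longrightarrow> \<psi> = \<phi>) \<and>
      (\<forall>\<psi>. outer_automorphism (sym_group 6) \<psi> \<longrightarrow>
        conjugate_homs (sym_group 6) (sym_group 6) \<psi> \<phi>) \<and>
      noncyclic_hom (braid_group 6) (sym_group 6) (\<phi> \<circ> standard_projection 6) \<and>
      \<not> conjugate_homs (braid_group 6) (sym_group 6)
          (\<phi> \<circ> standard_projection 6) (standard_projection 6) \<and>
      (\<forall>f. noncyclic_hom (braid_group 6) (sym_group 6) f \<longrightarrow>
        \<not> conjugate_homs (braid_group 6) (sym_group 6) f (standard_projection 6) \<longrightarrow>
        conjugate_homs (braid_group 6) (sym_group 6) f (\<phi> \<circ> standard_projection 6)))"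
proof (intro conjI allI impI exI[of _ outer6] ballI)
  show "conjugate_homs (braid_group n) (sym_group n) f (standard_projection n)"
    if "3 \<le> n" "n \<noteq> 4" "n \<noteq> 6" "noncyclic_hom (braid_group n) (sym_group n) f" for n f
    using noncyclic_braid_hom_conj_standard that by blast
  show "\<psi> = outer6"
    if "\<psi> \<in> auto (sym_group 6)"
      "\<psi> (cycle_of_list [1, 2]) = cycle_of_list [1, 2] \<circ> cycle_of_list [3, 4] \<circ> cycle_of_list [5, 6] \<and>
       \<psi> (cycle_of_list [1, 2, 3, 4, 5, 6]) = cycle_of_list [1, 2, 3] \<circ> cycle_of_list [4, 5]" for \<psi>
    using auto_eq_outer6I[OF that(1)] that(2) outer6_cycle_2 outer6_cycle_6 by metis
  show "noncyclic_hom (braid_group 6) (sym_group 6) (outer6 \<circ> standard_projection 6)"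
    by (rule noncyclic_comp_standard_projection[OF outer6_auto]) simp
qed (fact outer_automorphism_outer6 outer6_cycle_2 outer6_cycle_6 outer6_comp_projection_not_standard
    | erule outer_automorphism_conj_outer6 | erule (1) exceptional_braid_hom_conj)+

end
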